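(* The algebra $\tilde{\mathcal{A}}_{conv.}$ is left and right noetherian. Moreover, every normal left ideal and every normal right ideal of $\tilde{\mathcal{A}}_{conv.}$ is principal.
   Context: Let $\mathcal{A}_0$ be the $\mathbb{C}$-algebra of polynomials in $a,b$ subject to $ab-ba=b^2$, and $\widehat{\mathcal{A}}$ its completion for the $(a,b)$-adic topology (formal power series $\sum_{p,q\ge0}\gamma_{p,q}a^pb^q$). $\tilde{\mathcal{A}}_{conv.}\subset\widehat{\mathcal{A}}$ is the subalgebra of series for which there exist $R>1$, $C_R>0$ with $|\gamma_{p,q}|\le C_RR^{p+q}q!$ for all $p,q$. A left ideal $I\subset\tilde{\mathcal{A}}_{conv.}$ is called normal if $bx\in I$ implies $x\in I$; a right ideal $I$ is called normal if $xb\in I$ implies $x\in I$. *)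

theory Defs
  imports Complex_Main
begin

text \<open>A formal series \<open>\<Sum>_{p,q} \<gamma> p q a^p b^q\<close> in normally ordered monomials of the
  algebra \<open>ab - ba = b^2\<close> is represented by its coefficient function.\<close>

type_synonym jseries = "nat \<Rightarrow> nat \<Rightarrow> complex"

text \<open>\<open>nf q p s\<close> is the normally ordered form of the word \<open>b^q a^p b^s\<close>:
  its coefficient of \<open>a^m b^n\<close>.  It uses \<open>b^q a = a b^q - q b^(q+1)\<close>,
  which follows from \<open>ab - ba = b^2\<close>.\<close>
fun nf :: "nat \<Rightarrow> nat \<Rightarrow> nat \<Rightarrow> nat \<Rightarrow> nat \<Rightarrow> int" where
  "nf q 0 s = (\<lambda>m n. if m = 0 \<and> n = q + s then 1 else 0)"
| "nf q (Suc p) s = (\<lambda>m n. (if m = 0 then 0 else nf q p s (m - 1) n) - int q * nf (Suc q) p s m n)"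

text \<open>Structure constant: coefficient of \<open>a^m b^n\<close> in \<open>(a^p b^q)(a^p' b^q')\<close>.\<close>
definition struct_const :: "nat \<Rightarrow> nat \<Rightarrow> nat \<Rightarrow> nat \<Rightarrow> nat \<Rightarrow> nat \<Rightarrow> int" where
  "struct_const p q p' q' m n = (if p \<le> m then nf q p' q' (m - p) n else 0)"

text \<open>Product in the (a,b)-adic completion; the relation is homogeneous, so only
  monomials of total degree \<open>m+n\<close> contribute (a finite sum).\<close>
definition jmult :: "jseries \<Rightarrow> jseries \<Rightarrow> jseries" where
  "jmult f g = (\<lambda>m n. \<Sum>p\<le>m+n. \<Sum>q\<le>m+n. \<Sum>p'\<le>m+n. \<Sum>q'\<le>m+n.
      if p + q + p' + q' = m + n
      then f p q * g p' q' * of_int (struct_const p q p' q' m n) else 0)"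

definition jb :: jseries where
  "jb = (\<lambda>p q. if p = 0 \<and> q = 1 then 1 else 0)"

definition Aconv :: "jseries set" where
  "Aconv = {\<gamma>. \<exists>R>1. \<exists>C>0. \<forall>p q. norm (\<gamma> p q) \<le> C * R ^ (p + q) * fact q}"

definition add_subgroup :: "jseries set \<Rightarrow> bool" where
  "add_subgroup I \<longleftrightarrow> I \<subseteq> Aconv \<and> (\<lambda>p q. 0) \<in> I \<and>
    (\<forall>x\<in>I. \<forall>y\<in>I. (\<lambda>p q. x p q + y p q) \<in> I \<and> (\<lambda>p q. x p q - y p q) \<in> I)"

definition left_ideal :: "jseries set \<Rightarrow> bool" where
  "left_ideal I \<longleftrightarrow> add_subgroup I \<and> (\<forall>x\<in>Aconv. \<forall>y\<in>I. jmult x y \<in> I)"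

definition right_ideal :: "jseries set \<Rightarrow> bool" where
  "right_ideal I \<longleftrightarrow> add_subgroup I \<and> (\<forall>x\<in>Aconv. \<forall>y\<in>I. jmult y x \<in> I)"

definition left_noetherian :: bool where
  "left_noetherian \<longleftrightarrow> (\<forall>I :: nat \<Rightarrow> jseries set.
     (\<forall>n. left_ideal (I n)) \<and> (\<forall>n. I n \<subseteq> I (Suc n)) \<longrightarrow> (\<exists>N. \<forall>n\<ge>N. I n = I N))"

definition right_noetherian :: bool where
  "right_noetherian \<longleftrightarrow> (\<forall>I :: nat \<Rightarrow> jseries set.
     (\<forall>n. right_ideal (I n)) \<and> (\<forall>n. I n \<subseteq> I (Suc n)) \<longrightarrow> (\<exists>N. \<forall>n\<ge>N. I n = I N))"

definition normal_left_ideal :: "jseries set \<Rightarrow> bool" where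
  "normal_left_ideal I \<longleftrightarrow> left_ideal I \<and> (\<forall>x\<in>Aconv. jmult jb x \<in> I \<longrightarrow> x \<in> I)"

definition normal_right_ideal :: "jseries set \<Rightarrow> bool" where
  "normal_right_ideal I \<longleftrightarrow> right_ideal I \<and> (\<forall>x\<in>Aconv. jmult x jb \<in> I \<longrightarrow> x \<in> I)"

definition principal_left_ideal :: "jseries set \<Rightarrow> bool" where
  "principal_left_ideal I \<longleftrightarrow> (\<exists>g\<in>Aconv. I = {jmult x g | x. x \<in> Aconv})"

definition principal_right_ideal :: "jseries set \<Rightarrow> bool" where
  "principal_right_ideal I \<longleftrightarrow> (\<exists>g\<in>Aconv. I = {jmult g x | x. x \<in> Aconv})"

end

theory Submission
  imports Defs "HOL-Library.Extended_Nat" "HOL-Library.Function_Algebras"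
    "HOL-Computational_Algebra.Formal_Power_Series"
begin

text \<open>
  Letting \<open>a\<close> act on powers \<open>z^t\<close> as multiplication by \<open>z\<close> and \<open>b\<close> as integration gives a
  faithful representation, in which identities between products can be checked; the
  anti-automorphism \<open>a \<mapsto> a\<close>, \<open>b \<mapsto> -b\<close> becomes a reflection of \<open>t\<close> and exchanges left and right
  ideals, so only right ideals matter.

  The heart is a Weierstrass division theorem: if \<open>g\<close> is \<open>a^k\<close> times a unit modulo \<open>b\<close>, every \<open>x\<close>
  is \<open>g u + r\<close> with \<open>r\<close> of degree less than \<open>k\<close> in \<open>a\<close>.  The quotient \<open>u\<close> is determined
  recursively, and it converges because it is majorised by a multiple of
  \<open>(p + q)^q / (\<rho>^p \<sigma>^q)\<close> for suitably small \<open>\<rho>\<close> and \<open>\<sigma>\<close>.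

  Order exponents first by the power of \<open>b\<close>, then by that of \<open>a\<close>.  A right ideal is determined
  within any larger one by the least leading exponent at each power of \<open>b\<close>, which gives the
  chain condition; in a normal ideal an element with minimal leading exponent generates.
\<close>

subsection \<open>Decreasing sequences in well-orders\<close>

lemma antimono_wellorder_eventually_const:
  fixes f :: "nat \<Rightarrow> 'a :: wellorder"
  assumes "\<And>n. f (Suc n) \<le> f n"
  obtains N where "\<And>n. N \<le> n \<Longrightarrow> f n = f N"
proof -
  define v where "v = (LEAST v. v \<in> range f)"
  have "v \<in> range f" unfolding v_def by (rule LeastI[of _ "f 0"]) simp
  then obtain N where v_eq: "v = f N" by blast
  have "f n = f N" if "N \<le> n" for n
  proof (rule antisym)
    show "f n \<le> f N" using assms that by (rule lift_Suc_antimono_le)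
    show "f N \<le> f n" unfolding v_eq[symmetric] v_def by (rule Least_le) simp
  qed
  then show ?thesis by (rule that)
qed

lemma antimono2_wellorder_eventually_const:
  fixes f :: "nat \<Rightarrow> nat \<Rightarrow> 'a :: wellorder"
  assumes antimono_left: "\<And>n j. f (Suc n) j \<le> f n j"
    and antimono_right: "\<And>n j. f n (Suc j) \<le> f n j"
  obtains N where "\<And>n j. N \<le> n \<Longrightarrow> f n j = f N j"
proof -
  have antimono: "f n' j' \<le> f n j" if "n \<le> n'" "j \<le> j'" for n n' j j'
    using lift_Suc_antimono_le[of "\<lambda>n. f n j", OF antimono_left that(1)]
      lift_Suc_antimono_le[of "f n'", OF antimono_right that(2)] by (rule order_trans[rotated])
  obtain D where diagonal: "\<And>i. D \<le> i \<Longrightarrow> f i i = f D D"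
    using antimono_wellorder_eventually_const[of "\<lambda>i. f i i"] antimono by (metis le_SucI order_refl)
  have const_beyond_D: "f n j = f D D" if "D \<le> n" "D \<le> j" for n j
  proof (rule antisym)
    show "f n j \<le> f D D" using that by (rule antimono)
    show "f D D \<le> f n j"
      using diagonal[of "max n j"] that antimono[of n "max n j" j "max n j"] by simp
  qed
  have "\<exists>B. \<forall>n\<ge>B. f n j = f B j" for j
    using antimono_wellorder_eventually_const[of "\<lambda>n. f n j", OF antimono_left] by blast
  then obtain B where column_const: "\<And>j n. B j \<le> n \<Longrightarrow> f n j = f (B j) j" by metis
  define N where "N = Max (insert D (B ` {..<D}))"
  have N_ge: "D \<le> N" "\<And>j. j < D \<Longrightarrow> B j \<le> N" by (auto simp: N_def)
  have "f n j = f N j" if "N \<le> n" for n j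
  proof (cases "j < D")
    case True
    then show ?thesis
      using column_const[of j n] column_const[of j N] N_ge(2)[of j] that by simp
  next
    case False
    then show ?thesis
      using const_beyond_D[of n j] const_beyond_D[of N j] N_ge(1) that by simp
  qed
  then show ?thesis by (rule that)
qed

subsection \<open>Powers and factorials\<close>

lemma sum_power_le_geometric_tail:
  fixes y :: real
  assumes "0 \<le> y" "y < 1"
  shows "(\<Sum>i\<in>{k..<n}. y ^ i) \<le> y ^ k / (1 - y)"
proof -
  have "(\<Sum>i\<in>{k..<n}. y ^ i) = y ^ k * (\<Sum>i<n - k. y ^ i)"
    unfolding sum_distrib_left
    by (rule sum.reindex_bij_witness[where i = "\<lambda>i. i + k" and j = "\<lambda>i. i - k"])
      (auto simp flip: power_add)
  also have "(\<Sum>i<n - k. y ^ i) \<le> (\<Sum>i. y ^ i)"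
    using assms by (intro sum_le_suminf) auto
  finally show ?thesis using assms by (simp add: suminf_geometric mult_left_mono)
qed

lemma sum_power_le_double:
  fixes y :: real
  assumes "0 \<le> y" "y \<le> 1 / 2"
  shows "(\<Sum>i\<in>{k..<n}. y ^ i) \<le> 2 * y ^ k"
proof -
  have "(\<Sum>i\<in>{k..<n}. y ^ i) \<le> y ^ k / (1 - y)"
    using assms by (intro sum_power_le_geometric_tail) auto
  also have "\<dots> \<le> y ^ k / (1 / 2)" using assms by (intro divide_left_mono) auto
  finally show ?thesis by simp
qed

lemma of_nat_Suc_le_power_2: "real (Suc n) \<le> 2 ^ n"
  using of_nat_mono[OF Suc_leI[OF less_exp[of n]], where ?'a = real] by simp

lemma power_le_exp_mult_fact:
  assumes "0 \<le> (x :: real)"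
  shows "x ^ n \<le> exp x * fact n"
proof -
  have "x ^ n /\<^sub>R fact n \<le> (\<Sum>k. x ^ k /\<^sub>R fact k)"
    using sum_le_suminf[OF summable_exp_generic[of x], of "{n}"] assms by simp
  then show ?thesis by (simp add: exp_def field_simps)
qed

lemma fact_le_real_power: "fact n \<le> real n ^ n"
  using fact_le_power[of n, where ?'a = real] by simp

lemma fact_mult_fact_le: "fact m * fact n \<le> (fact (m + n) :: real)"
proof -
  have "fact m * fact n \<le> (fact (m + n) :: nat)"
    by (intro dvd_imp_le fact_fact_dvd_fact) auto
  then show ?thesis by (metis of_nat_fact of_nat_le_iff of_nat_mult)
qed

lemma fact_add_le: "fact (m + n) \<le> (2 ^ (m + n) * fact m * fact n :: real)"
proof -
  have "fact (m + n) = real (m + n choose m) * fact m * fact n" by (simp add: binomial_fact)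
  also have "\<dots> \<le> real (2 ^ (m + n)) * fact m * fact n"
    by (intro mult_right_mono of_nat_mono binomial_le_pow2) auto
  finally show ?thesis by simp
qed

subsection \<open>Pochhammer symbols\<close>

lemma pochhammer_of_nat_le: "pochhammer (real m) j \<le> 2 ^ (m + j) * fact j"
proof -
  have "pochhammer (real m) j \<le> pochhammer (real m + 1) j"
    unfolding pochhammer_prod by (intro prod_mono) auto
  also have "\<dots> = fact (m + j) / fact m"
    using pochhammer_product'[of "1::real" m j] by (simp add: add.commute flip: pochhammer_fact)
  also have "\<dots> \<le> 2 ^ (m + j) * fact j"
    using fact_add_le[of m j] by (simp add: divide_le_eq ac_simps)
  finally show ?thesis .
qed

lemma pochhammer_nonzero_if_not_Ints:
  fixes z :: "'a :: field_char_0"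
  shows "z \<notin> \<int> \<Longrightarrow> pochhammer z n \<noteq> 0"
  by (auto simp: pochhammer_eq_0_iff)

lemma inverse_pochhammer_diff:
  fixes z :: "'a :: field"
  assumes "pochhammer z (Suc q) \<noteq> 0"
  shows "1 / pochhammer z q - of_nat q / pochhammer z (Suc q) = 1 / pochhammer (z + 1) q"
proof -
  have nonzero: "z \<noteq> 0" "pochhammer (z + 1) q \<noteq> 0" using assms by (auto simp: pochhammer_rec)
  have "1 / pochhammer z q = (z + of_nat q) / pochhammer z (Suc q)"
    using assms by (simp add: pochhammer_Suc)
  then have "1 / pochhammer z q - of_nat q / pochhammer z (Suc q) = z / pochhammer z (Suc q)"
    by (simp flip: diff_divide_distrib)
  also have "\<dots> = 1 / pochhammer (z + 1) q"
    using nonzero by (simp add: pochhammer_rec)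
  finally show ?thesis .
qed

lemma tendsto_inverse_pochhammer_at_infinity:
  "((\<lambda>t. 1 / pochhammer t q) \<longlongrightarrow> (if q = 0 then 1 else 0 :: 'a :: real_normed_field)) at_infinity"
proof (induction q)
  case (Suc q)
  have "((\<lambda>t. inverse (t + of_nat q)) \<longlongrightarrow> (0 :: 'a)) at_infinity"
    by (rule filterlim_compose[OF tendsto_inverse_0
          tendsto_add_filterlim_at_infinity'[OF filterlim_ident tendsto_const]])
  from tendsto_mult[OF Suc this] show ?case by (simp add: pochhammer_Suc divide_inverse)
qed simp

lemma tendsto_sum_inverse_pochhammer_at_infinity:
  fixes c :: "nat \<Rightarrow> 'a :: real_normed_field"
  shows "((\<lambda>t. \<Sum>q\<le>n. c q / pochhammer t q) \<longlongrightarrow> c 0) at_infinity"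
proof -
  have "((\<lambda>t. \<Sum>q\<le>n. c q * (1 / pochhammer t q)) \<longlongrightarrow> (\<Sum>q\<le>n. c q * (if q = 0 then 1 else 0)))
      at_infinity"
    by (intro tendsto_sum tendsto_mult tendsto_const tendsto_inverse_pochhammer_at_infinity)
  also have "(\<Sum>q\<le>n. c q * (if q = 0 then 1 else 0)) = c 0" by (simp add: if_distrib cong: if_cong)
  finally show ?thesis by simp
qed

lemma sum_inverse_pochhammer_eq_0D:
  fixes c :: "nat \<Rightarrow> complex"
  assumes "\<And>t. t \<notin> \<int> \<Longrightarrow> (\<Sum>q\<le>n. c q / pochhammer t q) = 0" "q \<le> n"
  shows "c q = 0"
  using assms
proof (induction n arbitrary: c q)
  case 0
  have "\<i> \<notin> \<int>" by (auto elim!: Ints_cases simp: complex_eq_iff)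
  from 0(1)[OF this] 0(2) show ?case by simp
next
  case (Suc n)
  have "c 0 = 0"
  proof (rule LIMSEQ_unique)
    let ?t = "\<lambda>m. \<i> * of_nat (Suc m)"
    have "filterlim ?t at_infinity sequentially"
      by (intro tendsto_mult_filterlim_at_infinity[of _ "\<i>"] tendsto_const
          filterlim_compose[OF tendsto_of_nat filterlim_Suc]) auto
    then show "(\<lambda>m. \<Sum>q\<le>Suc n. c q / pochhammer (?t m) q) \<longlonglongrightarrow> c 0"
      by (rule filterlim_compose[OF tendsto_sum_inverse_pochhammer_at_infinity])
    have "?t m \<notin> \<int>" for m by (auto elim!: Ints_cases simp: complex_eq_iff)
    from Suc.prems(1)[OF this] show "(\<lambda>m. \<Sum>q\<le>Suc n. c q / pochhammer (?t m) q) \<longlonglongrightarrow> 0"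
      by (simp only: tendsto_const)
  qed
  moreover have "c (Suc q') = 0" if "q' \<le> n" for q'
  proof (rule Suc.IH[OF _ that])
    fix t :: complex assume nonint: "t \<notin> \<int>"
    then have "(\<Sum>q\<le>n. c (Suc q) / pochhammer t q)
        = (t - 1) * (\<Sum>q\<le>n. c (Suc q) / pochhammer (t - 1) (Suc q))"
      by (auto simp: pochhammer_rec sum_distrib_left intro!: sum.cong)
    also have "(\<Sum>q\<le>n. c (Suc q) / pochhammer (t - 1) (Suc q))
        = (\<Sum>q\<le>Suc n. c q / pochhammer (t - 1) q)"
      using \<open>c 0 = 0\<close> by (subst sum.atMost_Suc_shift) simp
    also have "\<dots> = 0" using nonint by (intro Suc.prems(1)) simp
    finally show "(\<Sum>q\<le>n. c (Suc q) / pochhammer t q) = 0" by simp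
  qed
  ultimately show ?case using Suc.prems(2) by (cases q) auto
qed

subsection \<open>Normal ordering\<close>

text \<open>\<open>b^q a^p = \<Sum>j\<le>p. reorder_coeff q p j a^(p-j) b^(q+j)\<close>\<close>
definition reorder_coeff :: "nat \<Rightarrow> nat \<Rightarrow> nat \<Rightarrow> int" where
  "reorder_coeff q p j = (-1) ^ j * int (p choose j) * pochhammer (int q) j"

lemma nf_eq_reorder_coeff:
  "nf q p s m n = (if m \<le> p \<and> m + n = p + q + s then reorder_coeff q p (p - m) else 0)"
proof (induction p arbitrary: q m n)
  case 0
  then show ?case by (auto simp: reorder_coeff_def)
next
  case (Suc p)
  show ?case
  proof (cases "m \<le> Suc p \<and> m + n = Suc p + q + s")
    case False
    then show ?thesis by (cases m) (auto simp: Suc.IH)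
  next
    case True
    consider (zero) "m = 0" | (top) "m = Suc p" | (between) m' where "m = Suc m'" "m' < p"
      using True by (cases m) (auto simp: le_less)
    then show ?thesis
    proof cases
      case zero
      then show ?thesis
        using True by (simp add: Suc.IH reorder_coeff_def pochhammer_rec ac_simps)
    next
      case top
      then show ?thesis using True by (simp add: Suc.IH reorder_coeff_def)
    next
      case (between m')
      then have "p - m' = Suc (p - Suc m')" by simp
      then show ?thesis using True between
        by (simp add: Suc.IH reorder_coeff_def pochhammer_rec[of "int q"] algebra_simps)
    qed
  qed
qed

lemma abs_reorder_coeff_le:
  "\<bar>real_of_int (reorder_coeff q p j)\<bar> \<le> 2 ^ (q + j) * (real (p choose j) * fact j)"
proof -
  have "0 \<le> pochhammer (real q) j" unfolding pochhammer_prod by (intro prod_nonneg) auto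
  then have "\<bar>real_of_int (reorder_coeff q p j)\<bar> = real (p choose j) * pochhammer (real q) j"
    by (simp add: reorder_coeff_def abs_mult power_abs flip: pochhammer_of_int)
  also have "\<dots> \<le> real (p choose j) * (2 ^ (q + j) * fact j)"
    by (intro mult_left_mono pochhammer_of_nat_le) auto
  finally show ?thesis by (simp only: ac_simps)
qed

lemma fact_mult_abs_reorder_coeff_le:
  "fact q * \<bar>real_of_int (reorder_coeff q p j)\<bar> \<le> 2 ^ (q + j + p) * fact (q + j)"
proof -
  have "real (p choose j) \<le> 2 ^ p"
    using binomial_le_pow2[of p j] by (metis of_nat_le_numeral_power_cancel_iff)
  then have "\<bar>real_of_int (reorder_coeff q p j)\<bar> \<le> 2 ^ (q + j) * (2 ^ p * fact j)"
    by (intro order_trans[OF abs_reorder_coeff_le] mult_left_mono mult_right_mono) auto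
  then have "fact q * \<bar>real_of_int (reorder_coeff q p j)\<bar>
      \<le> fact q * (2 ^ (q + j) * (2 ^ p * fact j))"
    by (rule mult_left_mono) simp
  also have "\<dots> = 2 ^ (q + j + p) * (fact q * fact j)" by (simp add: power_add)
  also have "\<dots> \<le> 2 ^ (q + j + p) * fact (q + j)"
    by (intro mult_left_mono fact_mult_fact_le) simp
  finally show ?thesis .
qed

lemma fact_mult_abs_nf_le:
  "fact q * \<bar>real_of_int (nf q p s m n)\<bar> \<le> 4 ^ (p + q) * fact n"
proof (cases "m \<le> p \<and> m + n = p + q + s")
  case True
  then have exponents: "q + (p - m) \<le> n" "q + (p - m) + p \<le> 2 * (p + q)" by auto
  have "fact q * \<bar>real_of_int (nf q p s m n)\<bar> \<le> 2 ^ (q + (p - m) + p) * fact (q + (p - m))"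
    using True fact_mult_abs_reorder_coeff_le[of q p "p - m"] by (simp add: nf_eq_reorder_coeff)
  also have "\<dots> \<le> 2 ^ (2 * (p + q)) * fact n"
    using exponents by (intro mult_mono power_increasing fact_mono) auto
  also have "\<dots> = 4 ^ (p + q) * fact n" by (simp only: power_mult) simp
  finally show ?thesis .
qed (auto simp: nf_eq_reorder_coeff)

definition exponent_quads :: "nat \<Rightarrow> (nat \<times> nat \<times> nat \<times> nat) set" where
  "exponent_quads n = {(p, q, p', q'). p + q + p' + q' = n}"

lemma finite_exponent_quads: "finite (exponent_quads n)"
  by (rule finite_subset[of _ "{..n} \<times> {..n} \<times> {..n} \<times> {..n}"]) (auto simp: exponent_quads_def)

lemma sum_exponent_quads:
  "sum f (exponent_quads n) = (\<Sum>i\<le>n. \<Sum>q\<le>i. \<Sum>q'\<le>n - i. f (i - q, q, n - i - q', q'))"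
proof -
  have "sum f (exponent_quads n)
      = (\<Sum>(i, q, q')\<in>(SIGMA i:{..n}. {..i} \<times> {..n - i}). f (i - q, q, n - i - q', q'))"
    by (rule sum.reindex_bij_witness[where i = "\<lambda>(i, q, q'). (i - q, q, n - i - q', q')"
          and j = "\<lambda>(p, q, p', q'). (p + q, q, q')"]) (auto simp: exponent_quads_def)
  then show ?thesis by (simp add: sum.Sigma sum.cartesian_product case_prod_unfold)
qed

lemma jmult_eq_sum_exponent_quads:
  "jmult x y m n = (\<Sum>(p, q, p', q')\<in>exponent_quads (m + n).
     x p q * y p' q' * of_int (struct_const p q p' q' m n))"
proof -
  let ?S = "{..m + n} \<times> {..m + n} \<times> {..m + n} \<times> {..m + n}"
  have "jmult x y m n = (\<Sum>(p, q, p', q')\<in>?S. if p + q + p' + q' = m + n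
      then x p q * y p' q' * of_int (struct_const p q p' q' m n) else 0)"
    unfolding jmult_def by (simp add: sum.cartesian_product)
  also have "\<dots> = (\<Sum>(p, q, p', q')\<in>exponent_quads (m + n).
     x p q * y p' q' * of_int (struct_const p q p' q' m n))"
    by (rule sum.mono_neutral_cong_right) (auto simp: exponent_quads_def split: if_splits)
  finally show ?thesis .
qed

definition jmult_term :: "jseries \<Rightarrow> jseries \<Rightarrow> nat \<Rightarrow> nat \<Rightarrow> nat \<times> nat \<times> nat \<Rightarrow> complex" where
  "jmult_term g u M N = (\<lambda>(r, m, j).
     g r m * u (M - r + j) (N - m - j) * of_int (reorder_coeff m (M - r + j) j))"

definition jmult_index :: "nat \<Rightarrow> nat \<Rightarrow> (nat \<times> nat \<times> nat) set" where
  "jmult_index M N = {(r, m, j). r \<le> M \<and> m + j \<le> N}"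

lemma finite_jmult_index: "finite (jmult_index M N)"
  by (rule finite_subset[of _ "{..M} \<times> {..N} \<times> {..N}"]) (auto simp: jmult_index_def)

lemma jmult_eq_sum_jmult_term: "jmult g u M N = sum (jmult_term g u M N) (jmult_index M N)"
proof -
  define Q where "Q = {(p, q, p', q') \<in> exponent_quads (M + N). p \<le> M \<and> M \<le> p + p'}"
  have "jmult g u M N
      = (\<Sum>(p, q, p', q')\<in>Q. g p q * u p' q' * of_int (struct_const p q p' q' M N))"
    unfolding jmult_eq_sum_exponent_quads
    by (rule sum.mono_neutral_right)
      (auto simp: Q_def finite_exponent_quads struct_const_def nf_eq_reorder_coeff split: if_splits)
  also have "\<dots> = sum (jmult_term g u M N) (jmult_index M N)"
  proof (rule sum.reindex_bij_witness[where
        i = "\<lambda>(r, m, j). (r, m, M - r + j, N - m - j)" and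
        j = "\<lambda>(p, q, p', q'). (p, q, p' - (M - p))"])
    fix z assume "z \<in> Q"
    then obtain p q p' q' where z: "z = (p, q, p', q')"
      "p + q + p' + q' = M + N" "p \<le> M" "M \<le> p + p'"
      by (auto simp: Q_def exponent_quads_def)
    then have "M - p + (p' - (M - p)) = p'" "N - q - (p' - (M - p)) = q'" by auto
    moreover have "struct_const p q p' q' M N = reorder_coeff q p' (p' - (M - p))"
      using z by (auto simp: struct_const_def nf_eq_reorder_coeff)
    ultimately show "jmult_term g u M N (case z of (p, q, p', q') \<Rightarrow> (p, q, p' - (M - p)))
        = (case z of (p, q, p', q') \<Rightarrow> g p q * u p' q' * of_int (struct_const p q p' q' M N))"
      by (simp add: z(1) jmult_term_def)
  qed (auto simp: Q_def exponent_quads_def jmult_index_def)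
  finally show ?thesis .
qed

subsection \<open>The action on powers\<close>

lemma sum_nf_div_pochhammer:
  fixes t :: "'a :: field_char_0"
  assumes "t \<notin> \<int>"
  shows "(\<Sum>n\<le>p + q + s. of_int (nf q p s (p + q + s - n) n) / pochhammer t n)
    = 1 / (pochhammer t s * pochhammer (t + of_nat (s + p)) q)"
proof (induction p arbitrary: q)
  case 0
  have "(\<Sum>n\<le>q + s. of_int (nf q 0 s (q + s - n) n) / pochhammer t n)
      = (\<Sum>n\<le>q + s. if n = q + s then 1 / pochhammer t n else 0)"
    by (intro sum.cong) auto
  then show ?case
    using pochhammer_product'[of t s q] by (simp add: add.commute)
next
  case (Suc p)
  let ?N = "p + q + s" and ?z = "t + of_nat (s + p)"
  have "(\<Sum>n\<le>Suc ?N. of_int (nf q (Suc p) s (Suc ?N - n) n) / pochhammer t n)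
      = (\<Sum>n\<le>Suc ?N. of_int (if n = Suc ?N then 0 else nf q p s (?N - n) n) / pochhammer t n)
        - of_nat q * (\<Sum>n\<le>Suc ?N. of_int (nf (Suc q) p s (Suc ?N - n) n) / pochhammer t n)"
    unfolding sum_distrib_left sum_subtractf[symmetric]
    by (intro sum.cong refl) (auto simp: diff_divide_distrib le_Suc_eq)
  also have "\<dots> = 1 / (pochhammer t s * pochhammer ?z q)
      - of_nat q * (1 / (pochhammer t s * pochhammer ?z (Suc q)))"
    using Suc.IH[of q] Suc.IH[of "Suc q"] by simp
  also have "\<dots> = 1 / pochhammer t s * (1 / pochhammer ?z q - of_nat q / pochhammer ?z (Suc q))"
    by (simp add: right_diff_distrib)
  also have "\<dots> = 1 / pochhammer t s * (1 / pochhammer (?z + 1) q)"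
    by (subst inverse_pochhammer_diff) (use assms in \<open>auto intro!: pochhammer_nonzero_if_not_Ints\<close>)
  finally show ?case by (simp add: ac_simps)
qed

lemma sum_struct_const_div_pochhammer:
  fixes t :: "'a :: field_char_0"
  assumes "t \<notin> \<int>" "(p, q, p', q') \<in> exponent_quads n"
  shows "(\<Sum>k\<le>n. of_int (struct_const p q p' q' (n - k) k) / pochhammer t k)
    = 1 / (pochhammer t q' * pochhammer (t + of_nat (q' + p')) q)"
proof -
  have n_eq: "n = p + (p' + q + q')" using assms(2) by (simp add: exponent_quads_def)
  have "(\<Sum>k\<le>n. of_int (struct_const p q p' q' (n - k) k) / pochhammer t k)
      = (\<Sum>k\<le>p' + q + q'. of_int (nf q p' q' (p' + q + q' - k) k) / pochhammer t k)"
    unfolding n_eq by (intro sum.mono_neutral_cong_right) (auto simp: struct_const_def add.assoc)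
  then show ?thesis using sum_nf_div_pochhammer[OF assms(1)] by simp
qed

text \<open>Letting \<open>a\<close> multiply by \<open>z\<close> and \<open>b\<close> integrate, this is the coefficient of \<open>z^(t+n-1)\<close> in
  \<open>x z^(t-1)\<close>.  For \<open>t \<in> \<int>\<close> a denominator may vanish.\<close>
definition action_coeff :: "jseries \<Rightarrow> nat \<Rightarrow> complex \<Rightarrow> complex" where
  "action_coeff x n t = (\<Sum>q\<le>n. x (n - q) q / pochhammer t q)"

lemma action_coeff_add: "action_coeff (x + y) n t = action_coeff x n t + action_coeff y n t"
  by (simp add: action_coeff_def add_divide_distrib sum.distrib)

theorem action_coeff_jmult:
  assumes "t \<notin> \<int>"
  shows "action_coeff (jmult x y) n t
    = (\<Sum>i\<le>n. action_coeff x i (t + of_nat (n - i)) * action_coeff y (n - i) t)"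
proof -
  have "action_coeff (jmult x y) n t = (\<Sum>k\<le>n. \<Sum>(p, q, p', q')\<in>exponent_quads n.
      x p q * y p' q' * (of_int (struct_const p q p' q' (n - k) k) / pochhammer t k))"
    unfolding action_coeff_def
    by (intro sum.cong refl)
      (auto simp: jmult_eq_sum_exponent_quads sum_divide_distrib case_prod_unfold)
  also have "\<dots> = (\<Sum>(p, q, p', q')\<in>exponent_quads n. x p q * y p' q' *
      (\<Sum>k\<le>n. of_int (struct_const p q p' q' (n - k) k) / pochhammer t k))"
    by (subst sum.swap) (simp add: sum_distrib_left case_prod_unfold)
  also have "\<dots> = (\<Sum>(p, q, p', q')\<in>exponent_quads n. x p q * y p' q' *
      (1 / (pochhammer t q' * pochhammer (t + of_nat (q' + p')) q)))"
    by (intro sum.cong refl) (auto simp: sum_struct_const_div_pochhammer[OF assms])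
  also have "\<dots> = (\<Sum>i\<le>n. action_coeff x i (t + of_nat (n - i)) * action_coeff y (n - i) t)"
    unfolding sum_exponent_quads action_coeff_def sum_product
    by (intro sum.cong refl) (simp add: mult.commute)
  finally show ?thesis .
qed

lemma jseries_eqI_action_coeff:
  assumes "\<And>n t. t \<notin> \<int> \<Longrightarrow> action_coeff x n t = action_coeff y n t"
  shows "x = y"
proof (intro ext)
  fix p q
  let ?c = "\<lambda>k. x (p + q - k) k - y (p + q - k) k"
  have "?c q = 0"
  proof (rule sum_inverse_pochhammer_eq_0D[where c = ?c and n = "p + q"])
    fix t :: complex assume "t \<notin> \<int>"
    then show "(\<Sum>k\<le>p + q. ?c k / pochhammer t k) = 0"
      using assms[of t "p + q"] by (simp add: action_coeff_def diff_divide_distrib sum_subtractf)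
  qed simp
  then show "x p q = y p q" by simp
qed

theorem jmult_assoc: "jmult (jmult x y) z = jmult x (jmult y z)"
proof (rule jseries_eqI_action_coeff)
  fix n and t :: complex assume nonint: "t \<notin> \<int>"
  define f where "f i j k = action_coeff x i (t + of_nat k + of_nat j)
      * action_coeff y j (t + of_nat k) * action_coeff z k t" for i j k
  have "action_coeff (jmult (jmult x y) z) n t = (\<Sum>i=0..n. \<Sum>k=0..i. f k (i - k) (n - i))"
    using nonint by (simp add: action_coeff_jmult sum_distrib_right atLeast0AtMost f_def)
  also have "\<dots> = (\<Sum>i=0..n. \<Sum>k=0..n - i. f i k (n - i - k))"
    by (rule fps_mult_assoc_lemma)
  also have "\<dots> = action_coeff (jmult x (jmult y z)) n t"
  proof -
    have "of_nat (n - i - k) + of_nat k = (of_nat (n - i) :: complex)" if "k \<le> n - i" for i k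
      using that by (simp flip: of_nat_add)
    then show ?thesis
      using nonint
      by (auto simp: action_coeff_jmult sum_distrib_left atLeast0AtMost f_def mult.assoc add.assoc
          simp del: of_nat_diff intro!: sum.cong)
  qed
  finally show "action_coeff (jmult (jmult x y) z) n t = action_coeff (jmult x (jmult y z)) n t" .
qed

subsection \<open>Multiplication by powers of b\<close>

definition jshift :: "nat \<Rightarrow> jseries \<Rightarrow> jseries" where
  "jshift j x = (\<lambda>p q. if q < j then 0 else x p (q - j))"

definition a_deriv :: "jseries \<Rightarrow> jseries" where
  "a_deriv x = (\<lambda>p q. of_nat (Suc p) * x (Suc p) q)"

text \<open>The automorphism \<open>x \<mapsto> b^(-1) x b\<close>, which fixes \<open>b\<close> and sends \<open>a\<close> to \<open>a + b\<close>.\<close>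
definition jtwist :: "jseries \<Rightarrow> jseries" where
  "jtwist x = x + jshift 1 (a_deriv x)"

lemma jmult_jb: "jmult x jb = jshift 1 x"
proof (intro ext)
  fix M N
  have "jmult x jb M N
      = (\<Sum>i\<in>(if N = 0 then {} else {(M, N - 1, 0)}). jmult_term x jb M N i)"
    unfolding jmult_eq_sum_jmult_term
    by (rule sum.mono_neutral_right[OF finite_jmult_index])
      (auto simp: jmult_term_def jb_def jmult_index_def split: if_splits)
  then show "jmult x jb M N = jshift 1 x M N"
    by (auto simp: jshift_def jmult_term_def jb_def reorder_coeff_def)
qed

lemma action_coeff_jshift_0: "action_coeff (jshift 1 x) 0 t = 0"
  by (simp add: action_coeff_def jshift_def)

lemma action_coeff_jshift_Suc: "action_coeff (jshift 1 x) (Suc n) t = action_coeff x n (t + 1) / t"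
proof -
  have "action_coeff (jshift 1 x) (Suc n) t = (\<Sum>q\<le>n. x (n - q) q / pochhammer t (Suc q))"
    unfolding action_coeff_def by (subst sum.atMost_Suc_shift) (simp add: jshift_def)
  then show ?thesis
    by (simp add: action_coeff_def pochhammer_rec sum_divide_distrib mult.commute)
qed

lemma action_coeff_jshift_a_deriv:
  "action_coeff (jshift 1 (a_deriv x)) n t
    = (\<Sum>q\<le>n. of_nat (n - q) * x (n - q) q / pochhammer t (Suc q))"
proof (cases n)
  case 0
  then show ?thesis by (simp only: action_coeff_jshift_0) simp
next
  case (Suc m)
  have "action_coeff (jshift 1 (a_deriv x)) n t
      = (\<Sum>q\<le>m. of_nat (Suc m - q) * x (Suc m - q) q / pochhammer t (Suc q))"
    unfolding Suc action_coeff_jshift_Suc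
    by (simp add: action_coeff_def a_deriv_def Suc_diff_le pochhammer_rec sum_divide_distrib
        mult.commute del: of_nat_Suc)
  then show ?thesis by (simp add: Suc)
qed

lemma action_coeff_jtwist:
  assumes "t \<notin> \<int>"
  shows "action_coeff (jtwist x) n t = (t + of_nat n) / t * action_coeff x n (t + 1)"
proof -
  have "x (n - q) q / pochhammer t q + of_nat (n - q) * x (n - q) q / pochhammer t (Suc q)
      = (t + of_nat n) / t * (x (n - q) q / pochhammer (t + 1) q)" if "q \<le> n" for q
  proof -
    have "pochhammer t q \<noteq> 0" "t + of_nat q \<noteq> 0"
      using pochhammer_nonzero_if_not_Ints[OF assms, of "Suc q"] by (auto simp: pochhammer_Suc)
    then have "x (n - q) q / pochhammer t q + of_nat (n - q) * x (n - q) q / pochhammer t (Suc q)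
        = (t + of_nat q + of_nat (n - q)) * x (n - q) q / pochhammer t (Suc q)"
      by (simp add: pochhammer_Suc divide_simps) (simp add: algebra_simps)
    also have "t + of_nat q + of_nat (n - q) = t + of_nat n"
      using that by (simp add: of_nat_diff)
    finally show ?thesis by (simp add: pochhammer_rec)
  qed
  then show ?thesis
    unfolding jtwist_def action_coeff_add action_coeff_jshift_a_deriv
    unfolding action_coeff_def sum_distrib_left sum.distrib[symmetric] by (intro sum.cong) auto
qed

lemma action_coeff_jb: "action_coeff jb n t = (if n = 1 then 1 / t else 0)"
proof -
  have "action_coeff jb n t = (\<Sum>q\<le>n. if q = n then (if n = 1 then 1 / t else 0) else 0)"
    unfolding action_coeff_def jb_def by (intro sum.cong) auto
  then show ?thesis by simp
qed

lemma jb_jmult_jtwist: "jmult jb (jtwist x) = jmult x jb"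
proof (rule jseries_eqI_action_coeff)
  fix n and t :: complex assume nonint: "t \<notin> \<int>"
  show "action_coeff (jmult jb (jtwist x)) n t = action_coeff (jmult x jb) n t"
  proof (cases n)
    case 0
    then show ?thesis
      by (simp add: action_coeff_jmult[OF nonint] action_coeff_jb)
  next
    case (Suc m)
    have "t + of_nat m \<noteq> 0" using nonint by (metis Ints_0 Ints_of_nat add_in_Ints_iff_right)
    have "action_coeff (jmult jb (jtwist x)) n t
        = (\<Sum>i\<le>Suc m. if i = 1 then action_coeff (jtwist x) m t / (t + of_nat m) else 0)"
      unfolding action_coeff_jmult[OF nonint] Suc by (intro sum.cong) (auto simp: action_coeff_jb)
    also have "\<dots> = action_coeff (jtwist x) m t / (t + of_nat m)" by simp
    also have "\<dots> = action_coeff x m (t + 1) / t"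
      using \<open>t + of_nat m \<noteq> 0\<close> by (simp add: action_coeff_jtwist[OF nonint])
    also have "\<dots> = action_coeff (jmult x jb) n t"
      unfolding jmult_jb Suc action_coeff_jshift_Suc ..
    finally show ?thesis .
  qed
qed

lemma jshift_Suc: "jshift (Suc j) x = jmult (jshift j x) jb"
  by (auto simp: jmult_jb jshift_def fun_eq_iff)

lemma jmult_jshift_jtwist: "jmult (jshift j x) ((jtwist ^^ j) y) = jshift j (jmult x y)"
proof (induction j arbitrary: y)
  case 0
  then show ?case by (simp add: jshift_def)
next
  case (Suc j)
  have "jmult (jshift (Suc j) x) ((jtwist ^^ Suc j) y)
      = jmult (jshift j x) (jmult jb (jtwist ((jtwist ^^ j) y)))"
    by (simp add: jshift_Suc jmult_assoc)
  also have "\<dots> = jmult (jmult (jshift j x) ((jtwist ^^ j) y)) jb"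
    by (simp add: jb_jmult_jtwist jmult_assoc)
  finally show ?case by (simp only: Suc.IH jshift_Suc)
qed

subsection \<open>The reversing anti-automorphism\<close>

text \<open>\<open>a \<mapsto> a\<close>, \<open>b \<mapsto> -b\<close>: it sends \<open>a^p b^q\<close> to \<open>(-1)^q b^q a^p\<close>.\<close>
definition jrev :: "jseries \<Rightarrow> jseries" where
  "jrev x = (\<lambda>m n. \<Sum>q\<le>m + n. (-1) ^ q * x (m + n - q) q * of_int (nf q (m + n - q) 0 m n))"

lemma jrev_add: "jrev (x + y) = jrev x + jrev y"
  by (simp add: jrev_def fun_eq_iff algebra_simps sum.distrib)

lemma jrev_diff: "jrev (x - y) = jrev x - jrev y"
  by (simp add: jrev_def fun_eq_iff algebra_simps sum_subtractf)

lemma jrev_0: "jrev 0 = 0"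
  by (simp add: jrev_def fun_eq_iff)

lemma jrev_jb: "jrev jb = - jb"
proof (intro ext)
  fix m n
  have "jrev jb m n = (\<Sum>q\<le>m + n. if q = 1 then (if m = 0 \<and> n = 1 then -1 else 0) else 0)"
    unfolding jrev_def jb_def by (intro sum.cong) auto
  then show "jrev jb m n = (- jb) m n" by (auto simp: jb_def)
qed

lemma jmult_uminus_left: "jmult (- x) y = - jmult x y"
  by (simp add: fun_eq_iff jmult_eq_sum_jmult_term jmult_term_def case_prod_unfold sum_negf)

lemma jmult_0_left: "jmult 0 y = 0"
  by (simp add: fun_eq_iff jmult_eq_sum_jmult_term jmult_term_def)

lemma action_coeff_jrev:
  assumes "t \<notin> \<int>"
  shows "action_coeff (jrev x) n t = action_coeff x n (1 - t - of_nat n)"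
proof -
  have "action_coeff (jrev x) n t = (\<Sum>k\<le>n. \<Sum>q\<le>n. (-1) ^ q * x (n - q) q *
      (of_int (nf q (n - q) 0 (n - k) k) / pochhammer t k))"
    unfolding action_coeff_def jrev_def by (intro sum.cong) (auto simp: sum_divide_distrib)
  also have "\<dots> = (\<Sum>q\<le>n. (-1) ^ q * x (n - q) q *
      (\<Sum>k\<le>n. of_int (nf q (n - q) 0 (n - k) k) / pochhammer t k))"
    unfolding sum_distrib_left by (rule sum.swap)
  also have "\<dots> = (\<Sum>q\<le>n. (-1) ^ q * x (n - q) q * (1 / pochhammer (t + of_nat (n - q)) q))"
  proof (intro sum.cong refl)
    fix q assume "q \<in> {..n}"
    then show "(-1) ^ q * x (n - q) q * (\<Sum>k\<le>n. of_int (nf q (n - q) 0 (n - k) k) / pochhammer t k)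
        = (-1) ^ q * x (n - q) q * (1 / pochhammer (t + of_nat (n - q)) q)"
      using sum_nf_div_pochhammer[OF assms, of q "n - q" 0] by simp
  qed
  also have "\<dots> = action_coeff x n (1 - t - of_nat n)"
    unfolding action_coeff_def
  proof (intro sum.cong refl)
    fix q assume "q \<in> {..n}"
    then have "pochhammer (1 - t - of_nat n) q = (-1) ^ q * pochhammer (t + of_nat (n - q)) q"
      using pochhammer_minus[of "t + of_nat n - 1" q] by (simp add: of_nat_diff algebra_simps)
    moreover have "(-1) ^ q * y = y / (-1) ^ q" for y :: complex
      by (cases "even q") auto
    ultimately show "(-1) ^ q * x (n - q) q * (1 / pochhammer (t + of_nat (n - q)) q)
        = x (n - q) q / pochhammer (1 - t - of_nat n) q" by simp
  qed
  finally show ?thesis .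
qed

lemma jrev_jrev: "jrev (jrev x) = x"
  by (rule jseries_eqI_action_coeff) (simp add: action_coeff_jrev)

theorem jrev_jmult: "jrev (jmult x y) = jmult (jrev y) (jrev x)"
proof (rule jseries_eqI_action_coeff)
  fix n and t :: complex assume nonint: "t \<notin> \<int>"
  let ?t = "1 - t - of_nat n"
  have "action_coeff (jrev (jmult x y)) n t
      = (\<Sum>i\<le>n. action_coeff x i (?t + of_nat (n - i)) * action_coeff y (n - i) ?t)"
    using nonint by (simp add: action_coeff_jrev action_coeff_jmult)
  also have "\<dots> = (\<Sum>i\<le>n. action_coeff x (n - i) (?t + of_nat i) * action_coeff y i ?t)"
    by (rule sum.reindex_bij_witness[where i = "\<lambda>i. n - i" and j = "\<lambda>i. n - i"]) auto
  also have "\<dots>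
      = (\<Sum>i\<le>n. action_coeff (jrev y) i (t + of_nat (n - i)) * action_coeff (jrev x) (n - i) t)"
    using nonint by (intro sum.cong refl) (auto simp: action_coeff_jrev of_nat_diff algebra_simps)
  finally show "action_coeff (jrev (jmult x y)) n t = action_coeff (jmult (jrev y) (jrev x)) n t"
    by (simp add: action_coeff_jmult[OF nonint])
qed

lemma jrev_jmult_jb: "jrev (jmult x jb) = - jmult jb (jrev x)"
  by (simp add: jrev_jmult jrev_jb jmult_uminus_left)

subsection \<open>Closure properties of convergent series\<close>

definition gevrey_bounded :: "real \<Rightarrow> real \<Rightarrow> jseries \<Rightarrow> bool" where
  "gevrey_bounded R C x \<longleftrightarrow> (\<forall>p q. norm (x p q) \<le> C * R ^ (p + q) * fact q)"

lemma gevrey_boundedI: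
  "(\<And>p q. norm (x p q) \<le> C * R ^ (p + q) * fact q) \<Longrightarrow> gevrey_bounded R C x"
  by (simp add: gevrey_bounded_def)

lemma gevrey_boundedD: "gevrey_bounded R C x \<Longrightarrow> norm (x p q) \<le> C * R ^ (p + q) * fact q"
  by (simp add: gevrey_bounded_def)

lemma gevrey_bounded_mono:
  assumes "gevrey_bounded R C x" "0 \<le> R" "R \<le> S" "0 \<le> C" "C \<le> D"
  shows "gevrey_bounded S D x"
proof (rule gevrey_boundedI)
  fix p q
  have "C * R ^ (p + q) * fact q \<le> D * S ^ (p + q) * fact q"
    using assms by (intro mult_mono mult_right_mono power_mono) auto
  with gevrey_boundedD[OF assms(1)] show "norm (x p q) \<le> D * S ^ (p + q) * fact q"
    by (rule order_trans)
qed

lemma AconvI: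
  assumes "1 < R" "0 \<le> C" "gevrey_bounded R C x"
  shows "x \<in> Aconv"
proof -
  have "gevrey_bounded R (C + 1) x" using assms by (intro gevrey_bounded_mono[OF assms(3)]) auto
  moreover have "0 < C + 1" using assms(2) by simp
  ultimately show ?thesis
    using assms(1) unfolding Aconv_def gevrey_bounded_def by blast
qed

lemma AconvE:
  assumes "x \<in> Aconv"
  obtains R C where "1 < R" "0 < C" "gevrey_bounded R C x"
  using assms unfolding Aconv_def gevrey_bounded_def by blast

lemma Aconv_common_bound:
  assumes "x \<in> Aconv" "y \<in> Aconv"
  obtains R C where "1 < R" "0 < C" "gevrey_bounded R C x" "gevrey_bounded R C y"
proof -
  obtain R C where x: "1 < R" "0 < C" "gevrey_bounded R C x" using assms(1) by (rule AconvE)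
  obtain S D where y: "1 < S" "0 < D" "gevrey_bounded S D y" using assms(2) by (rule AconvE)
  show ?thesis
  proof
    show "1 < max R S" "0 < max C D" using x y by auto
    show "gevrey_bounded (max R S) (max C D) x" using x by (intro gevrey_bounded_mono[OF x(3)]) auto
    show "gevrey_bounded (max R S) (max C D) y" using y by (intro gevrey_bounded_mono[OF y(3)]) auto
  qed
qed

lemma Aconv_0: "0 \<in> Aconv"
  by (intro AconvI[of 2 0] gevrey_boundedI) auto

lemma Aconv_jb: "jb \<in> Aconv"
  by (intro AconvI[of 2 1] gevrey_boundedI) (auto simp: jb_def)

lemma Aconv_add:
  assumes "x \<in> Aconv" "y \<in> Aconv"
  shows "x + y \<in> Aconv"
proof -
  obtain R C where pos: "1 < R" "0 < C"
    and bounds: "gevrey_bounded R C x" "gevrey_bounded R C y"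
    using assms by (rule Aconv_common_bound)
  show ?thesis
  proof (intro AconvI gevrey_boundedI)
    fix p q
    show "norm ((x + y) p q) \<le> (2 * C) * R ^ (p + q) * fact q"
      using norm_triangle_le[OF add_mono[OF bounds[THEN gevrey_boundedD]], of p q p q]
      by (simp add: ac_simps)
  qed (use pos in auto)
qed

lemma Aconv_jshift:
  assumes "x \<in> Aconv"
  shows "jshift j x \<in> Aconv"
proof -
  obtain R C where pos: "1 < R" "0 < C" and bounded: "gevrey_bounded R C x"
    using assms by (rule AconvE)
  note x_bound = gevrey_boundedD[OF bounded]
  show ?thesis
  proof (intro AconvI gevrey_boundedI)
    fix p q
    have "norm (x p (q - j)) \<le> C * R ^ (p + q) * fact q"
      by (rule order_trans[OF x_bound])
        (use pos in \<open>intro mult_mono mult_left_mono power_increasing fact_mono; simp\<close>)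
    then show "norm (jshift j x p q) \<le> C * R ^ (p + q) * fact q"
      using pos by (simp add: jshift_def)
  qed (use pos in auto)
qed

definition junshift :: "nat \<Rightarrow> jseries \<Rightarrow> jseries" where
  "junshift j x = (\<lambda>p q. x p (q + j))"

lemma Aconv_junshift:
  assumes "x \<in> Aconv"
  shows "junshift j x \<in> Aconv"
proof -
  obtain R C where pos: "1 < R" "0 < C" and bounded: "gevrey_bounded R C x"
    using assms by (rule AconvE)
  note x_bound = gevrey_boundedD[OF bounded]
  show ?thesis
  proof (intro AconvI gevrey_boundedI)
    fix p q
    have "norm (junshift j x p q) \<le> C * R ^ (p + (q + j)) * fact (q + j)"
      unfolding junshift_def by (rule x_bound)
    also have "\<dots> \<le> C * R ^ (p + (q + j)) * (2 ^ (p + (q + j)) * fact q * fact j)"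
    proof (rule mult_left_mono)
      have "(2 :: real) ^ (q + j) \<le> 2 ^ (p + (q + j))" by (intro power_increasing) auto
      then show "fact (q + j) \<le> (2 ^ (p + (q + j)) * fact q * fact j :: real)"
        by (intro order_trans[OF fact_add_le] mult_right_mono) auto
    qed (use pos in auto)
    finally show "norm (junshift j x p q) \<le> (C * (2 * R) ^ j * fact j) * (2 * R) ^ (p + q) * fact q"
      by (simp add: power_add power_mult_distrib ac_simps)
  qed (use pos in auto)
qed

lemma Aconv_a_deriv:
  assumes "x \<in> Aconv"
  shows "a_deriv x \<in> Aconv"
proof -
  obtain R C where pos: "1 < R" "0 < C" and bounded: "gevrey_bounded R C x"
    using assms by (rule AconvE)
  note x_bound = gevrey_boundedD[OF bounded]
  show ?thesis
  proof (intro AconvI gevrey_boundedI)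
    fix p q
    have "(2 :: real) ^ p \<le> 2 ^ (p + q)" by simp
    then have "real (Suc p) \<le> 2 ^ (p + q)" using of_nat_Suc_le_power_2[of p] by linarith
    then have "norm (a_deriv x p q) \<le> 2 ^ (p + q) * (C * R ^ (Suc p + q) * fact q)"
      unfolding a_deriv_def norm_mult norm_of_nat
      using x_bound[of "Suc p" q] by (intro mult_mono) auto
    then show "norm (a_deriv x p q) \<le> (C * R) * (2 * R) ^ (p + q) * fact q"
      by (simp add: power_mult_distrib ac_simps)
  qed (use pos in auto)
qed

lemma Aconv_funpow_jtwist: "x \<in> Aconv \<Longrightarrow> (jtwist ^^ j) x \<in> Aconv"
  by (induction j) (auto simp: jtwist_def intro!: Aconv_add Aconv_jshift Aconv_a_deriv)

lemma Aconv_jrev: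
  assumes "x \<in> Aconv"
  shows "jrev x \<in> Aconv"
proof -
  obtain R C where pos: "1 < R" "0 < C" and bounded: "gevrey_bounded R C x"
    using assms by (rule AconvE)
  note x_bound = gevrey_boundedD[OF bounded]
  show ?thesis
  proof (intro AconvI gevrey_boundedI)
    fix m n :: nat
    let ?N = "m + n"
    have "norm ((-1) ^ q * x (?N - q) q * of_int (nf q (?N - q) 0 m n))
        \<le> C * (4 * R) ^ ?N * fact n" if "q \<le> ?N" for q
    proof -
      let ?c = "\<bar>real_of_int (nf q (?N - q) 0 m n)\<bar>"
      have "norm ((-1) ^ q * x (?N - q) q * of_int (nf q (?N - q) 0 m n))
          = norm (x (?N - q) q) * ?c"
        by (simp add: norm_mult norm_power)
      also have "\<dots> \<le> (C * R ^ ?N * fact q) * ?c"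
        using x_bound[of "?N - q" q] that by (intro mult_right_mono) auto
      also have "\<dots> = C * R ^ ?N * (fact q * ?c)" by simp
      also have "\<dots> \<le> C * R ^ ?N * (4 ^ ?N * fact n)"
        using fact_mult_abs_nf_le[of q "?N - q" 0 m n] that pos by (intro mult_left_mono) auto
      finally show ?thesis by (simp add: power_mult_distrib ac_simps)
    qed
    then have "norm (jrev x m n) \<le> (\<Sum>q\<le>?N. C * (4 * R) ^ ?N * fact n)"
      unfolding jrev_def by (intro sum_norm_le) auto
    also have "\<dots> = real (Suc ?N) * (C * (4 * R) ^ ?N * fact n)" by simp
    also have "\<dots> \<le> 2 ^ ?N * (C * (4 * R) ^ ?N * fact n)"
      using pos by (intro mult_right_mono of_nat_Suc_le_power_2) auto
    also have "\<dots> = C * (8 * R) ^ ?N * fact n"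
      by (simp add: power_mult_distrib flip: power_mult_distrib[of 2 4])
    finally show "norm (jrev x m n) \<le> C * (8 * R) ^ ?N * fact n" .
  qed (use pos in auto)
qed

subsection \<open>Weierstrass division\<close>

text \<open>The indices whose terms in \<open>jmult g u (p + k) q\<close> need not vanish if \<open>g r 0 = 0\<close> for \<open>r < k\<close>,
  without the index \<open>(k, 0, 0)\<close> of \<open>g k 0 * u p q\<close>.\<close>
definition division_index :: "nat \<Rightarrow> nat \<Rightarrow> nat \<Rightarrow> (nat \<times> nat \<times> nat) set" where
  "division_index k p q = {(r, m, j) \<in> jmult_index (p + k) q. 0 < m \<or> k < r \<and> j = 0}"

lemma finite_division_index: "finite (division_index k p q)"
  by (rule finite_subset[OF _ finite_jmult_index[of "p + k" q]]) (auto simp: division_index_def)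

lemma jmult_eq_leading_term_plus_sum:
  assumes "\<forall>r<k. g r 0 = 0"
  shows "jmult g u (p + k) q
    = g k 0 * u p q + sum (jmult_term g u (p + k) q) (division_index k p q)"
proof -
  let ?f = "jmult_term g u (p + k) q"
  have "jmult g u (p + k) q = sum ?f (insert (k, 0, 0) (division_index k p q))"
    unfolding jmult_eq_sum_jmult_term
  proof (rule sum.mono_neutral_right[OF finite_jmult_index])
    show "\<forall>i\<in>jmult_index (p + k) q - insert (k, 0, 0) (division_index k p q). ?f i = 0"
      using assms
      by (auto simp: jmult_term_def jmult_index_def division_index_def reorder_coeff_def
          pochhammer_0_left not_less le_less split: if_splits)
  qed (auto simp: jmult_index_def division_index_def)
  also have "\<dots> = ?f (k, 0, 0) + sum ?f (division_index k p q)"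
    by (rule sum.insert[OF finite_division_index]) (simp add: division_index_def)
  finally show ?thesis by (simp add: jmult_term_def reorder_coeff_def)
qed

text \<open>The equation \<open>jmult g u (p + k) q = x (p + k) q\<close> determines \<open>u p q\<close> from the values of \<open>u\<close> at
  smaller exponents, ordered by the power of \<open>b\<close> first.\<close>
function division_quotient :: "nat \<Rightarrow> jseries \<Rightarrow> jseries \<Rightarrow> jseries" where
  "division_quotient k g x p q = (x (p + k) q -
     (\<Sum>(r, m, j)\<in>division_index k p q. g r m * division_quotient k g x (p + k - r + j) (q - m - j)
       * of_int (reorder_coeff m (p + k - r + j) j))) / g k 0"
  by auto
termination
  by (relation "inv_image (less_than <*lex*> less_than) (\<lambda>(k, g, x, p, q). (q, p))")
    (auto simp: division_index_def jmult_index_def)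

declare division_quotient.simps [simp del]

lemma jmult_division_quotient:
  assumes "\<forall>r<k. g r 0 = 0" "g k 0 \<noteq> 0"
  shows "jmult g (division_quotient k g x) (p + k) q = x (p + k) q"
proof -
  have "g k 0 * division_quotient k g x p q = x (p + k) q
      - sum (jmult_term g (division_quotient k g x) (p + k) q) (division_index k p q)"
    using assms(2) by (subst division_quotient.simps) (simp add: jmult_term_def)
  then show ?thesis by (simp add: jmult_eq_leading_term_plus_sum[of k g, OF assms(1)])
qed

text \<open>The majorant for quotients.  The power \<open>(p + q)^q\<close> absorbs the factor \<open>(p + j)^j\<close> arising
  from moving \<open>b\<close> past \<open>a^(p+j)\<close>, yet passing from \<open>p\<close> to \<open>p + k\<close> costs only a constant.\<close>
definition division_weight :: "real \<Rightarrow> real \<Rightarrow> nat \<Rightarrow> nat \<Rightarrow> real" where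
  "division_weight \<rho> \<sigma> p q = real (p + q) ^ q / (\<rho> ^ p * \<sigma> ^ q)"

lemma division_weight_nonneg: "0 < \<rho> \<Longrightarrow> 0 < \<sigma> \<Longrightarrow> 0 \<le> division_weight \<rho> \<sigma> p q"
  by (simp add: division_weight_def)

lemma fact_mult_division_weight_le:
  assumes "0 < \<rho>" "0 < \<sigma>"
  shows "fact m * division_weight \<rho> \<sigma> (p + j) q * \<bar>real_of_int (reorder_coeff m (p + j) j)\<bar>
    \<le> division_weight \<rho> \<sigma> (p + r) (q + j + m) * (\<rho> ^ r * (2 * \<sigma>) ^ m * (2 * \<sigma> / \<rho>) ^ j)"
proof -
  define n where "n = p + r + q + j + m"
  let ?c = "\<bar>real_of_int (reorder_coeff m (p + j) j)\<bar>"
  have "(p + j choose j) * fact j \<le> n ^ j"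
    by (rule order_trans[OF binomial_fact_pow]) (simp add: n_def power_mono)
  then have "real (p + j choose j) * fact j \<le> real n ^ j"
    by (metis of_nat_fact of_nat_le_iff of_nat_mult of_nat_power)
  then have "?c \<le> 2 ^ (m + j) * real n ^ j"
    by (intro order_trans[OF abs_reorder_coeff_le] mult_left_mono) auto
  moreover have "fact m \<le> real n ^ m"
    by (rule order_trans[OF fact_le_real_power]) (simp add: n_def power_mono)
  moreover have "real (p + j + q) ^ q \<le> real n ^ q"
    by (intro power_mono) (auto simp: n_def)
  ultimately have "fact m * real (p + j + q) ^ q * ?c
      \<le> real n ^ m * real n ^ q * (2 ^ (m + j) * real n ^ j)"
    by (intro mult_mono) auto
  then have "fact m * real (p + j + q) ^ q * ?c / (\<rho> ^ (p + j) * \<sigma> ^ q)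
      \<le> real n ^ m * real n ^ q * (2 ^ (m + j) * real n ^ j) / (\<rho> ^ (p + j) * \<sigma> ^ q)"
    using assms by (intro divide_right_mono) auto
  also have "\<dots> = division_weight \<rho> \<sigma> (p + r) (q + j + m)
      * (\<rho> ^ r * (2 * \<sigma>) ^ m * (2 * \<sigma> / \<rho>) ^ j)"
    using assms unfolding division_weight_def n_def
    by (simp add: power_add power_mult_distrib power_divide add.assoc field_simps)
  finally show ?thesis by (simp add: division_weight_def ac_simps)
qed

lemma division_weight_add_left_le:
  assumes "0 < \<rho>" "0 < \<sigma>"
  shows "division_weight \<rho> \<sigma> (p + k) q \<le> (exp 1 / \<rho>) ^ k * division_weight \<rho> \<sigma> p q"
proof -
  have "real (p + k + q) ^ q \<le> exp (real k) * real (p + q) ^ q"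
  proof (cases "q = 0")
    case False
    have "real (p + k + q) ^ q = (1 + real k / real (p + q)) ^ q * real (p + q) ^ q"
      using False by (simp add: field_simps flip: power_mult_distrib)
    also have "\<dots> \<le> exp (real k / real (p + q)) ^ q * real (p + q) ^ q"
      by (intro mult_right_mono power_mono exp_ge_add_one_self) auto
    also have "exp (real k / real (p + q)) ^ q \<le> exp (real k)"
      using False by (simp add: exp_of_nat_mult[symmetric] field_simps)
    finally show ?thesis by (simp add: mult_right_mono)
  qed simp
  then show ?thesis
    using assms
    by (simp add: division_weight_def power_add power_divide field_simps flip: exp_of_nat_mult)
qed

lemma power_mult_fact_le_division_weight:
  assumes "0 < \<rho>" "0 < \<sigma>" "0 \<le> R" "R * \<rho> \<le> 1" "R * \<sigma> \<le> 1"
  shows "R ^ (p + q) * fact q \<le> division_weight \<rho> \<sigma> p q"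
proof -
  have "(R ^ (p + q) * fact q) * (\<rho> ^ p * \<sigma> ^ q) = (R * \<rho>) ^ p * (R * \<sigma>) ^ q * fact q"
    by (simp add: power_add power_mult_distrib)
  also have "\<dots> \<le> 1 * 1 * real (p + q) ^ q"
    using assms
    by (intro mult_mono power_le_one order_trans[OF fact_le_real_power] power_mono) auto
  finally show ?thesis using assms by (simp add: division_weight_def pos_le_divide_eq)
qed

lemma division_weight_le_power_mult_fact:
  assumes "0 < \<sigma>" "\<sigma> \<le> \<rho>"
  shows "division_weight \<rho> \<sigma> p q \<le> (exp 1 / \<sigma>) ^ (p + q) * fact q"
proof -
  have "division_weight \<rho> \<sigma> p q \<le> (exp (real (p + q)) * fact q) / (\<sigma> ^ p * \<sigma> ^ q)"
    unfolding division_weight_def using assms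
    by (intro frac_le mult_right_mono power_mono power_le_exp_mult_fact) auto
  then show ?thesis by (simp add: power_divide power_add exp_add flip: exp_of_nat_mult)
qed

lemma sum_powers_division_index_le:
  fixes \<alpha> \<beta> \<gamma> :: real
  assumes "0 \<le> \<alpha>" "\<alpha> \<le> 1 / 2" "0 \<le> \<beta>" "\<beta> \<le> 1 / 2" "0 \<le> \<gamma>" "\<gamma> \<le> 1 / 2"
  shows "(\<Sum>(r, m, j)\<in>division_index k p q. \<alpha> ^ r * \<beta> ^ m * \<gamma> ^ j) \<le> 2 * \<alpha> ^ Suc k + 8 * \<beta>"
proof -
  let ?f = "\<lambda>(r, m, j). \<alpha> ^ r * \<beta> ^ m * \<gamma> ^ j"
  define A where "A = {Suc k..<Suc (p + k)} \<times> {0 :: nat} \<times> {0 :: nat}"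
  define B where "B = {0..<Suc (p + k)} \<times> {1..<Suc q} \<times> {0..<Suc q}"
  have "sum ?f (division_index k p q) \<le> sum ?f (A \<union> B)"
    by (rule sum_mono2)
      (use assms in \<open>auto simp: A_def B_def division_index_def jmult_index_def\<close>)
  also have "\<dots> = sum ?f A + sum ?f B"
    by (rule sum.union_disjoint) (auto simp: A_def B_def)
  also have "sum ?f A = (\<Sum>r\<in>{Suc k..<Suc (p + k)}. \<alpha> ^ r)"
    unfolding A_def by (simp add: sum.cartesian_product[symmetric])
  also have "\<dots> \<le> 2 * \<alpha> ^ Suc k" using assms by (intro sum_power_le_double)
  also have "sum ?f B = (\<Sum>r\<in>{0..<Suc (p + k)}. \<alpha> ^ r)
      * ((\<Sum>m\<in>{1..<Suc q}. \<beta> ^ m) * (\<Sum>j\<in>{0..<Suc q}. \<gamma> ^ j))"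
    unfolding B_def by (simp add: mult.assoc del: sum.op_ivl_Suc
        flip: sum.cartesian_product sum_distrib_left sum_distrib_right)
  also have "\<dots> \<le> (2 * \<alpha> ^ 0) * ((2 * \<beta> ^ 1) * (2 * \<gamma> ^ 0))"
    using assms by (intro mult_mono sum_power_le_double mult_nonneg_nonneg sum_nonneg) auto
  finally show ?thesis by simp
qed

lemma norm_jmult_term_le:
  fixes g u :: jseries
  assumes pos: "0 < \<rho>" "0 < \<sigma>" "0 \<le> R" "0 \<le> C" "0 \<le> B"
    and g_bounded: "gevrey_bounded R C g"
    and u_bound: "norm (u (M - r + j) (N - m - j))
      \<le> B * division_weight \<rho> \<sigma> (M - r + j) (N - m - j)"
    and index: "(r, m, j) \<in> jmult_index M N"
  shows "norm (jmult_term g u M N (r, m, j))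
    \<le> C * B * division_weight \<rho> \<sigma> M N * ((R * \<rho>) ^ r * (2 * R * \<sigma>) ^ m * (2 * \<sigma> / \<rho>) ^ j)"
proof -
  let ?w = "division_weight \<rho> \<sigma> (M - r + j) (N - m - j)"
  let ?c = "\<bar>real_of_int (reorder_coeff m (M - r + j) j)\<bar>"
  have "norm (jmult_term g u M N (r, m, j)) = norm (g r m) * norm (u (M - r + j) (N - m - j)) * ?c"
    by (simp add: jmult_term_def norm_mult)
  also have "\<dots> \<le> (C * R ^ (r + m) * fact m) * (B * ?w) * ?c"
    using pos
    by (intro mult_mono gevrey_boundedD[OF g_bounded] u_bound) (auto simp: division_weight_nonneg)
  also have "\<dots> = C * B * R ^ (r + m) * (fact m * ?w * ?c)" by simp
  also have "\<dots> \<le> C * B * R ^ (r + m) * (division_weight \<rho> \<sigma> (M - r + r) (N - m - j + j + m)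
      * (\<rho> ^ r * (2 * \<sigma>) ^ m * (2 * \<sigma> / \<rho>) ^ j))"
    using pos by (intro mult_left_mono fact_mult_division_weight_le) auto
  also have "\<dots> = C * B * division_weight \<rho> \<sigma> M N
      * ((R * \<rho>) ^ r * (2 * R * \<sigma>) ^ m * (2 * \<sigma> / \<rho>) ^ j)"
    using index by (simp add: jmult_index_def power_add power_mult_distrib)
  finally show ?thesis .
qed

definition division_radii :: "nat \<Rightarrow> real \<Rightarrow> real \<Rightarrow> real \<Rightarrow> real \<Rightarrow> real \<Rightarrow> bool" where
  "division_radii k R C d \<rho> \<sigma> \<longleftrightarrow> 0 < \<rho> \<and> 0 < \<sigma> \<and>
     R * \<rho> \<le> 1 / 2 \<and> 2 * R * \<sigma> \<le> 1 / 2 \<and> 2 * \<sigma> / \<rho> \<le> 1 / 2 \<and>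
     C * (exp 1 / \<rho>) ^ k * (2 * (R * \<rho>) ^ Suc k + 16 * R * \<sigma>) \<le> d / 2"

lemma division_radii_exist:
  assumes "0 < d"
  obtains \<rho> \<sigma> where "division_radii k R C d \<rho> \<sigma>"
proof -
  have small: "\<forall>\<^sub>F s in at_right 0. c * s < e" if "0 < e" for c e :: real
  proof -
    have "((\<lambda>s. c * s) \<longlongrightarrow> c * 0) (at_right 0)" by (intro tendsto_intros)
    then show ?thesis using that by (intro order_tendstoD(2)) auto
  qed
  have "\<forall>\<^sub>F \<rho> in at_right 0. 0 < \<rho> \<and> R * \<rho> < 1 / 2 \<and> (2 * C * exp 1 ^ k * R ^ Suc k) * \<rho> < d / 4"
    using assms by (intro eventually_conj small eventually_at_right_less) auto
  then obtain \<rho> where \<rho>: "0 < \<rho>" "R * \<rho> < 1 / 2" "(2 * C * exp 1 ^ k * R ^ Suc k) * \<rho> < d / 4"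
    using eventually_happens'[OF trivial_limit_at_right_real] by blast
  have "\<forall>\<^sub>F \<sigma> in at_right 0. 0 < \<sigma> \<and> (2 * R) * \<sigma> < 1 / 2 \<and> (2 / \<rho>) * \<sigma> < 1 / 2
      \<and> (16 * C * (exp 1 / \<rho>) ^ k * R) * \<sigma> < d / 4"
    using assms by (intro eventually_conj small eventually_at_right_less) auto
  then obtain \<sigma> where \<sigma>: "0 < \<sigma>" "(2 * R) * \<sigma> < 1 / 2" "(2 / \<rho>) * \<sigma> < 1 / 2"
      "(16 * C * (exp 1 / \<rho>) ^ k * R) * \<sigma> < d / 4"
    using eventually_happens'[OF trivial_limit_at_right_real] by blast
  have "C * (exp 1 / \<rho>) ^ k * (2 * (R * \<rho>) ^ Suc k + 16 * R * \<sigma>)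
      = (2 * C * exp 1 ^ k * R ^ Suc k) * \<rho> + (16 * C * (exp 1 / \<rho>) ^ k * R) * \<sigma>"
    using \<rho>(1) by (simp add: power_divide power_mult_distrib field_simps)
  with \<rho> \<sigma> show ?thesis by (intro that[of \<rho> \<sigma>]) (auto simp: division_radii_def)
qed

lemma norm_division_sum_le:
  fixes g u :: jseries
  assumes radii: "division_radii k R C d \<rho> \<sigma>" and pos: "0 \<le> R" "0 \<le> C" "0 \<le> B"
    and g_bounded: "gevrey_bounded R C g"
    and u_bound: "\<And>p' q'. q' < q \<or> q' = q \<and> p' < p \<Longrightarrow> norm (u p' q') \<le> B * division_weight \<rho> \<sigma> p' q'"
  shows "norm (sum (jmult_term g u (p + k) q) (division_index k p q))
    \<le> d / 2 * B * division_weight \<rho> \<sigma> p q"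
proof -
  let ?w = "division_weight \<rho> \<sigma>" and ?E = "(exp 1 / \<rho>) ^ k"
  let ?geom = "\<lambda>(r, m, j). (R * \<rho>) ^ r * (2 * R * \<sigma>) ^ m * (2 * \<sigma> / \<rho>) ^ j"
  have \<rho>\<sigma>: "0 < \<rho>" "0 < \<sigma>" using radii by (auto simp: division_radii_def)
  have "norm (sum (jmult_term g u (p + k) q) (division_index k p q))
      \<le> (\<Sum>i\<in>division_index k p q. C * B * ?w (p + k) q * ?geom i)"
  proof (intro sum_norm_le)
    fix i assume "i \<in> division_index k p q"
    then obtain r m j where i: "i = (r, m, j)" "(r, m, j) \<in> jmult_index (p + k) q"
      and smaller: "0 < m \<or> k < r \<and> j = 0"
      by (auto simp: division_index_def)
    then have "q - m - j < q \<or> q - m - j = q \<and> p + k - r + j < p"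
      by (auto simp: jmult_index_def)
    then show "norm (jmult_term g u (p + k) q i) \<le> C * B * ?w (p + k) q * ?geom i"
      unfolding i(1) prod.case using i(2) \<rho>\<sigma> pos by (intro norm_jmult_term_le g_bounded u_bound)
  qed
  also have "\<dots> = C * B * ?w (p + k) q * sum ?geom (division_index k p q)"
    by (simp add: sum_distrib_left)
  also have "\<dots> \<le> C * B * (?E * ?w p q) * (2 * (R * \<rho>) ^ Suc k + 8 * (2 * R * \<sigma>))"
    using radii pos
    by (intro mult_mono mult_left_mono division_weight_add_left_le sum_powers_division_index_le)
      (auto simp: division_radii_def division_weight_nonneg intro!: sum_nonneg)
  also have "\<dots> = (C * ?E * (2 * (R * \<rho>) ^ Suc k + 16 * R * \<sigma>)) * (B * ?w p q)"
    by simp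
  also have "\<dots> \<le> d / 2 * (B * ?w p q)"
    using radii pos
    by (intro mult_right_mono) (auto simp: division_radii_def division_weight_nonneg)
  finally show ?thesis by simp
qed

lemma norm_division_quotient_le:
  fixes g x :: jseries
  assumes radii: "division_radii k R C (norm (g k 0)) \<rho> \<sigma>" and pos: "0 \<le> R" "0 \<le> C"
    and g0: "\<forall>r<k. g r 0 = 0" and gk: "g k 0 \<noteq> 0"
    and g_bounded: "gevrey_bounded R C g" and x_bounded: "gevrey_bounded R C x"
  shows "norm (division_quotient k g x p q)
    \<le> 2 * C * (exp 1 / \<rho>) ^ k / norm (g k 0) * division_weight \<rho> \<sigma> p q"
proof (induction q arbitrary: p rule: less_induct)
  case outer: (less q)
  show ?case
  proof (induction p rule: less_induct)
    case inner: (less p)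
    let ?u = "division_quotient k g x" and ?w = "division_weight \<rho> \<sigma>"
    let ?d = "norm (g k 0)" and ?E = "(exp 1 / \<rho>) ^ k"
    let ?tail = "sum (jmult_term g ?u (p + k) q) (division_index k p q)"
    have \<rho>\<sigma>: "0 < \<rho>" "0 < \<sigma>" "R * \<rho> \<le> 1 / 2" "2 * R * \<sigma> \<le> 1 / 2"
      using radii by (auto simp: division_radii_def)
    have "norm (x (p + k) q) \<le> C * (R ^ (p + k + q) * fact q)"
      using gevrey_boundedD[OF x_bounded, of "p + k" q] by (simp only: mult.assoc)
    also have "\<dots> \<le> C * ?w (p + k) q"
      using \<rho>\<sigma> pos by (intro mult_left_mono power_mult_fact_le_division_weight) auto
    also have "\<dots> \<le> C * (?E * ?w p q)"
      using \<rho>\<sigma> pos by (intro mult_left_mono division_weight_add_left_le)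
    finally have x_le: "norm (x (p + k) q) \<le> C * (?E * ?w p q)" .
    have "norm ?tail \<le> ?d / 2 * (2 * C * ?E / ?d) * ?w p q"
      using pos \<rho>\<sigma> outer inner by (intro norm_division_sum_le[OF radii pos _ g_bounded]) auto
    then have tail_le: "norm ?tail \<le> C * (?E * ?w p q)" using gk by simp
    have "g k 0 * ?u p q = x (p + k) q - ?tail"
      using jmult_division_quotient[of k g, OF g0 gk] jmult_eq_leading_term_plus_sum[of k g, OF g0]
      by (metis add_diff_cancel_right')
    then have "?d * norm (?u p q) \<le> norm (x (p + k) q) + norm ?tail"
      by (metis norm_mult norm_triangle_ineq4)
    with x_le tail_le have "?d * norm (?u p q) \<le> 2 * C * ?E * ?w p q" by simp
    then show ?case using gk by (simp add: pos_le_divide_eq mult.commute)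
  qed
qed

theorem weierstrass_division:
  assumes "g \<in> Aconv" "x \<in> Aconv" and g0: "\<forall>r<k. g r 0 = 0" and gk: "g k 0 \<noteq> 0"
  obtains u where "u \<in> Aconv" "\<And>p q. jmult g u (p + k) q = x (p + k) q"
proof
  obtain R C where pos: "1 < R" "0 < C"
    and bounded: "gevrey_bounded R C g" "gevrey_bounded R C x"
    using assms(1,2) by (rule Aconv_common_bound)
  obtain \<rho> \<sigma> where radii: "division_radii k R C (norm (g k 0)) \<rho> \<sigma>"
    using gk by (rule division_radii_exist[OF zero_less_norm_iff[THEN iffD2]])
  define B where "B = 2 * C * (exp 1 / \<rho>) ^ k / norm (g k 0)"
  have \<sigma>: "0 < \<sigma>" "\<sigma> \<le> \<rho>" "2 * R * \<sigma> \<le> 1 / 2"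
    using radii by (auto simp: division_radii_def field_simps)
  have "0 \<le> B" using pos \<sigma> by (simp add: B_def)
  show "division_quotient k g x \<in> Aconv"
  proof (intro AconvI gevrey_boundedI)
    have "1 * \<sigma> \<le> R * \<sigma>" using pos \<sigma> by (intro mult_right_mono) auto
    then have "\<sigma> < 1" using \<sigma> by linarith
    moreover have "1 < exp (1 :: real)" by simp
    ultimately show "1 < exp 1 / \<sigma>" using \<sigma>(1) by (simp only: pos_less_divide_eq)
    fix p q
    have "norm (division_quotient k g x p q) \<le> B * division_weight \<rho> \<sigma> p q"
      unfolding B_def using pos
      by (intro norm_division_quotient_le[of k R C g, OF radii _ _ g0 gk bounded]) auto
    also have "\<dots> \<le> B * ((exp 1 / \<sigma>) ^ (p + q) * fact q)"
      using \<sigma> \<open>0 \<le> B\<close> by (intro mult_left_mono division_weight_le_power_mult_fact)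
    finally show "norm (division_quotient k g x p q) \<le> B * (exp 1 / \<sigma>) ^ (p + q) * fact q"
      by simp
  qed fact
  show "jmult g (division_quotient k g x) (p + k) q = x (p + k) q" for p q
    using g0 gk by (rule jmult_division_quotient)
qed

subsection \<open>Leading exponents\<close>

definition b_adic :: "nat \<Rightarrow> jseries set" where
  "b_adic j = {x. \<forall>p. \<forall>q<j. x p q = 0}"

definition has_lead_exp :: "jseries \<Rightarrow> nat \<Rightarrow> nat \<Rightarrow> bool" where
  "has_lead_exp x k j \<longleftrightarrow> x \<in> b_adic j \<and> (\<forall>p<k. x p j = 0) \<and> x k j \<noteq> 0"

definition min_lead :: "jseries set \<Rightarrow> nat \<Rightarrow> enat" where
  "min_lead I j = (INF k\<in>{k. \<exists>x\<in>I. has_lead_exp x k j}. enat k)"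

lemma b_adic_0: "b_adic 0 = UNIV"
  by (simp add: b_adic_def)

lemma b_adic_diff: "x \<in> b_adic j \<Longrightarrow> y \<in> b_adic j \<Longrightarrow> x - y \<in> b_adic j"
  by (simp add: b_adic_def)

lemma b_adic_Suc_iff: "x \<in> b_adic (Suc j) \<longleftrightarrow> x \<in> b_adic j \<and> (\<forall>p. x p j = 0)"
  by (auto simp: b_adic_def less_Suc_eq)

lemma jshift_in_b_adic: "jshift j x \<in> b_adic j"
  by (simp add: b_adic_def jshift_def)

lemma jshift_junshift: "x \<in> b_adic j \<Longrightarrow> jshift j (junshift j x) = x"
  by (auto simp: b_adic_def jshift_def junshift_def fun_eq_iff)

lemma has_lead_exp_jshift_iff: "has_lead_exp (jshift j x) k (j + i) \<longleftrightarrow> has_lead_exp x k i"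
proof -
  have "jshift j x \<in> b_adic (j + i) \<longleftrightarrow> x \<in> b_adic i"
  proof
    assume "jshift j x \<in> b_adic (j + i)"
    then have "jshift j x p (j + q) = 0" if "q < i" for p q
      using that by (simp add: b_adic_def)
    then show "x \<in> b_adic i" by (simp add: b_adic_def jshift_def)
  qed (auto simp: b_adic_def jshift_def)
  then show ?thesis by (auto simp: has_lead_exp_def jshift_def)
qed

lemma min_lead_le: "x \<in> I \<Longrightarrow> has_lead_exp x k j \<Longrightarrow> min_lead I j \<le> enat k"
  unfolding min_lead_def by (intro INF_lower) auto

lemma min_lead_attained:
  assumes "min_lead I j = enat k"
  obtains x where "x \<in> I" "has_lead_exp x k j"
proof -
  let ?A = "enat ` {k. \<exists>x\<in>I. has_lead_exp x k j}"
  have "?A \<noteq> {}"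
    using assms unfolding min_lead_def by (metis Inf_empty enat.distinct(1) top_enat_def)
  then have "Inf ?A \<in> ?A" by (meson ex_in_conv wellorder_InfI)
  then show ?thesis using assms that by (auto simp: min_lead_def)
qed

lemma min_lead_mono:
  assumes "\<And>x k. x \<in> I \<Longrightarrow> has_lead_exp x k j \<Longrightarrow> \<exists>y\<in>J. has_lead_exp y k i"
  shows "min_lead J i \<le> min_lead I j"
  unfolding min_lead_def using assms by (intro INF_superset_mono) auto

lemma coeff_eq_0_below_min_lead:
  assumes "x \<in> I" "x \<in> b_adic j" "enat p < min_lead I j"
  shows "x p j = 0"
proof (rule ccontr)
  assume nonzero: "x p j \<noteq> 0"
  then obtain k where least: "x k j \<noteq> 0" "\<forall>p<k. x p j = 0"
    using exists_least_iff[of "\<lambda>k. x k j \<noteq> 0"] by blast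
  then have "min_lead I j \<le> enat k"
    using assms(1,2) by (intro min_lead_le) (auto simp: has_lead_exp_def)
  also have "enat k \<le> enat p" using least(2) nonzero by (simp add: not_less[symmetric]) blast
  finally show False using assms(3) by simp
qed

lemma eq_0_if_below_min_lead:
  assumes "x \<in> I" "x \<in> b_adic j"
    and below: "\<And>p q. j \<le> q \<Longrightarrow> x p q \<noteq> 0 \<Longrightarrow> enat p < min_lead I q"
  shows "x = 0"
proof -
  have in_b_adic: "x \<in> b_adic (j + i)" for i
  proof (induction i)
    case (Suc i)
    have "x p (j + i) = 0" for p
      using below[of "j + i" p] coeff_eq_0_below_min_lead[OF assms(1) Suc, of p] by auto
    with Suc show ?case by (simp add: b_adic_Suc_iff)
  qed (simp add: assms(2))
  have "x p q = 0" for p q using in_b_adic[of "Suc q"] by (simp add: b_adic_def)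
  then show ?thesis by (simp add: fun_eq_iff)
qed

definition agree_from :: "enat \<Rightarrow> jseries \<Rightarrow> jseries \<Rightarrow> bool" where
  "agree_from \<mu> x y \<longleftrightarrow> (\<forall>p q. \<mu> \<le> enat p \<longrightarrow> x p q = y p q)"

lemma division_by_has_lead_exp:
  assumes "y \<in> Aconv" "has_lead_exp y k j" and x: "x \<in> Aconv" "x \<in> b_adic j"
  shows "\<exists>v\<in>Aconv. jmult y v \<in> b_adic j \<and> agree_from (enat k) (jmult y v) x"
proof -
  let ?w = "junshift j y"
  have y: "y \<in> b_adic j" using assms(2) by (simp add: has_lead_exp_def)
  have lead: "\<forall>p<k. ?w p 0 = 0" "?w k 0 \<noteq> 0"
    using assms(2) by (auto simp: has_lead_exp_def junshift_def)
  obtain u where u: "u \<in> Aconv" "\<And>p q. jmult ?w u (p + k) q = junshift j x (p + k) q"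
    using weierstrass_division[OF Aconv_junshift[OF assms(1)] Aconv_junshift[OF x(1)] lead] by blast
  have product: "jmult y ((jtwist ^^ j) u) = jshift j (jmult ?w u)"
    using jmult_jshift_jtwist[of j ?w u] y by (simp add: jshift_junshift)
  have "jshift j (jmult ?w u) p q = x p q" if "k \<le> p" for p q
  proof -
    have "jmult ?w u p = junshift j x p" using u(2)[of "p - k"] that by (simp add: fun_eq_iff)
    then have "jshift j (jmult ?w u) p q = jshift j (junshift j x) p q" by (simp add: jshift_def)
    then show ?thesis by (simp add: jshift_junshift[OF x(2)])
  qed
  then have "agree_from (enat k) (jmult y ((jtwist ^^ j) u)) x"
    by (simp add: agree_from_def product)
  moreover have "jmult y ((jtwist ^^ j) u) \<in> b_adic j" by (simp add: product jshift_in_b_adic)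
  ultimately show ?thesis using Aconv_funpow_jtwist[OF u(1)] by blast
qed

subsection \<open>Right ideals\<close>

lemma add_subgroup_iff:
  "add_subgroup I \<longleftrightarrow> I \<subseteq> Aconv \<and> 0 \<in> I \<and> (\<forall>x\<in>I. \<forall>y\<in>I. x + y \<in> I \<and> x - y \<in> I)"
  by (simp add: add_subgroup_def zero_fun_def plus_fun_def fun_diff_def)

lemma
  assumes "right_ideal I"
  shows right_ideal_Aconv: "x \<in> I \<Longrightarrow> x \<in> Aconv"
    and right_ideal_0: "0 \<in> I"
    and right_ideal_add: "x \<in> I \<Longrightarrow> y \<in> I \<Longrightarrow> x + y \<in> I"
    and right_ideal_diff: "x \<in> I \<Longrightarrow> y \<in> I \<Longrightarrow> x - y \<in> I"
    and right_ideal_jmult: "x \<in> I \<Longrightarrow> v \<in> Aconv \<Longrightarrow> jmult x v \<in> I"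
  using assms by (auto simp: right_ideal_def add_subgroup_iff)

lemma min_lead_Suc_le:
  assumes "right_ideal I"
  shows "min_lead I (Suc j) \<le> min_lead I j"
proof (rule min_lead_mono)
  fix x k assume "x \<in> I" "has_lead_exp x k j"
  then have "jmult x jb \<in> I" "has_lead_exp (jmult x jb) k (Suc j)"
    using right_ideal_jmult[OF assms _ Aconv_jb] has_lead_exp_jshift_iff[of 1 x k j]
    by (simp_all add: jmult_jb)
  then show "\<exists>y\<in>I. has_lead_exp y k (Suc j)" by blast
qed

lemma exists_divisor_at_min_lead:
  assumes I: "right_ideal I"
  shows "\<exists>g\<in>I. \<forall>x\<in>Aconv \<inter> b_adic j. \<exists>v\<in>Aconv.
    jmult g v \<in> b_adic j \<and> agree_from (min_lead I j) (jmult g v) x"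
proof (cases "min_lead I j")
  case (enat k)
  then obtain g where "g \<in> I" "has_lead_exp g k j" by (rule min_lead_attained)
  with enat show ?thesis
    using division_by_has_lead_exp[OF right_ideal_Aconv[OF I]] by (metis IntE)
next
  case infinity
  then have "jmult 0 0 \<in> b_adic j \<and> agree_from (min_lead I j) (jmult 0 0) x" for x
    by (simp add: jmult_0_left b_adic_def agree_from_def)
  then show ?thesis using right_ideal_0[OF I] Aconv_0 by blast
qed

lemma right_ideal_approximation:
  assumes "right_ideal I" "x \<in> Aconv" "x \<in> b_adic j"
  obtains z where "z \<in> I" "z \<in> b_adic j" "agree_from (min_lead I j) z x"
  using exists_divisor_at_min_lead[OF assms(1), of j] assms right_ideal_jmult[OF assms(1)] by blast

lemma eq_if_agree_from_min_lead:
  assumes I: "right_ideal I" "x \<in> I" "z \<in> I" and b_adic: "x \<in> b_adic j" "z \<in> b_adic j"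
    and const: "\<And>q. j \<le> q \<Longrightarrow> min_lead I q = min_lead I j"
    and agree: "agree_from (min_lead I j) z x"
  shows "x = z"
proof -
  have "x - z = 0"
  proof (rule eq_0_if_below_min_lead)
    show "x - z \<in> I" using I by (rule right_ideal_diff)
    show "x - z \<in> b_adic j" using b_adic by (rule b_adic_diff)
    fix p q assume "j \<le> q" "(x - z) p q \<noteq> 0"
    then show "enat p < min_lead I q"
      using agree const[of q] by (auto simp: agree_from_def not_le[symmetric])
  qed
  then show ?thesis by simp
qed

lemma right_ideal_reduction:
  assumes I: "right_ideal I" and J: "right_ideal J" and "I \<subseteq> J"
    and lead: "min_lead I j = min_lead J j" and x: "x \<in> J" "x \<in> b_adic j"
  obtains z where "z \<in> I" "z \<in> b_adic j" "agree_from (min_lead J j) z x"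
    "x - z \<in> J" "x - z \<in> b_adic (Suc j)"
proof -
  obtain z where z: "z \<in> I" "z \<in> b_adic j" "agree_from (min_lead J j) z x"
    using right_ideal_approximation[OF I right_ideal_Aconv[OF J x(1)] x(2)] lead by metis
  have remainder: "x - z \<in> J" "x - z \<in> b_adic j"
    using z x \<open>I \<subseteq> J\<close> by (auto intro: right_ideal_diff[OF J] b_adic_diff)
  have "(x - z) p j = 0" for p
    using coeff_eq_0_below_min_lead[OF remainder, of p] z(3)
    by (cases "min_lead J j \<le> enat p") (auto simp: agree_from_def)
  then have "x - z \<in> b_adic (Suc j)" using remainder(2) by (simp only: b_adic_Suc_iff) blast
  with z remainder(1) show ?thesis by (intro that)
qed

text \<open>Descending induction on the \<open>b\<close>-order of \<open>x \<in> J\<close>: once the least leading exponents have become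
  constant, a single reduction leaves remainder \<open>0\<close>.\<close>
theorem right_ideal_eqI_min_lead:
  assumes I: "right_ideal I" and J: "right_ideal J" and "I \<subseteq> J"
    and lead: "\<And>j. min_lead I j = min_lead J j"
  shows "I = J"
proof -
  obtain n where lead_const: "\<And>j. n \<le> j \<Longrightarrow> min_lead J j = min_lead J n"
    using antimono_wellorder_eventually_const[of "min_lead J", OF min_lead_Suc_le[OF J]] by blast
  have "x \<in> I" if "x \<in> J" "x \<in> b_adic j" "n \<le> j + i" for x i j
    using that
  proof (induction i arbitrary: j x)
    case (0 j x)
    obtain z where z: "z \<in> I" "z \<in> b_adic j" "agree_from (min_lead J j) z x"
      using right_ideal_reduction[OF I J \<open>I \<subseteq> J\<close> lead 0(1,2)] by blast
    have const: "min_lead J q = min_lead J j" if "j \<le> q" for q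
      using lead_const[of q] lead_const[of j] 0(3) that by simp
    have "z \<in> J" using z(1) \<open>I \<subseteq> J\<close> by blast
    then have "x = z" by (rule eq_if_agree_from_min_lead[OF J 0(1) _ 0(2) z(2) const z(3)])
    with z(1) show ?case by simp
  next
    case (Suc i j x)
    obtain z where z: "z \<in> I" "x - z \<in> J" "x - z \<in> b_adic (Suc j)"
      using right_ideal_reduction[OF I J \<open>I \<subseteq> J\<close> lead Suc.prems(1,2)] by blast
    from z(2,3) have "x - z \<in> I" by (rule Suc.IH) (use Suc.prems(3) in simp)
    then have "(x - z) + z \<in> I" using z(1) by (rule right_ideal_add[OF I])
    then show ?case by simp
  qed
  from this[of _ 0 n] have "J \<subseteq> I" by (auto simp: b_adic_0)
  with \<open>I \<subseteq> J\<close> show ?thesis by blast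
qed

theorem right_noetherian_Aconv: right_noetherian
  unfolding right_noetherian_def
proof (intro allI impI)
  fix I :: "nat \<Rightarrow> jseries set"
  assume "(\<forall>n. right_ideal (I n)) \<and> (\<forall>n. I n \<subseteq> I (Suc n))"
  then have I: "\<And>n. right_ideal (I n)" and chain: "\<And>n. I n \<subseteq> I (Suc n)" by auto
  have "min_lead (I (Suc n)) j \<le> min_lead (I n) j" for n j
    using chain[of n] by (intro min_lead_mono) auto
  then obtain N where stable: "\<And>n j. N \<le> n \<Longrightarrow> min_lead (I n) j = min_lead (I N) j"
    using antimono2_wellorder_eventually_const[of "\<lambda>n. min_lead (I n)"] min_lead_Suc_le[OF I]
    by blast
  have "I N = I n" if "N \<le> n" for n
    using lift_Suc_mono_le[of I, OF chain that] stable[OF that]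
    by (intro right_ideal_eqI_min_lead I) auto
  then show "\<exists>N. \<forall>n\<ge>N. I n = I N" by blast
qed

lemma normal_right_ideal_min_lead:
  assumes "normal_right_ideal I"
  shows "min_lead I j = min_lead I 0"
proof (induction j)
  case (Suc j)
  have I: "right_ideal I" using assms by (simp add: normal_right_ideal_def)
  have "min_lead I j \<le> min_lead I (Suc j)"
  proof (rule min_lead_mono)
    fix x k assume x: "x \<in> I" "has_lead_exp x k (Suc j)"
    then have "x \<in> b_adic 1" by (auto simp: has_lead_exp_def b_adic_def)
    then have unshift: "jshift 1 (junshift 1 x) = x" by (rule jshift_junshift)
    have "junshift 1 x \<in> Aconv" using right_ideal_Aconv[OF I x(1)] by (rule Aconv_junshift)
    moreover have "jmult (junshift 1 x) jb \<in> I" using x(1) by (simp only: jmult_jb unshift)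
    ultimately have "junshift 1 x \<in> I" using assms by (simp add: normal_right_ideal_def)
    moreover have "has_lead_exp (junshift 1 x) k j"
      using x(2) has_lead_exp_jshift_iff[of 1 "junshift 1 x" k j] unfolding unshift by simp
    ultimately show "\<exists>y\<in>I. has_lead_exp y k j" by blast
  qed
  with min_lead_Suc_le[OF I, of j] Suc show ?case by simp
qed simp

theorem normal_right_ideal_principal:
  assumes "normal_right_ideal I"
  shows "principal_right_ideal I"
proof -
  have I: "right_ideal I" using assms by (simp add: normal_right_ideal_def)
  obtain g where g: "g \<in> I" and division: "\<And>x. x \<in> Aconv \<Longrightarrow>
      \<exists>v\<in>Aconv. agree_from (min_lead I 0) (jmult g v) x"
    using exists_divisor_at_min_lead[OF I, of 0] by (auto simp: b_adic_0)
  have "\<exists>v\<in>Aconv. x = jmult g v" if x: "x \<in> I" for x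
  proof -
    obtain v where v: "v \<in> Aconv" "agree_from (min_lead I 0) (jmult g v) x"
      using division[OF right_ideal_Aconv[OF I x]] by blast
    have "x = jmult g v"
      using normal_right_ideal_min_lead[OF assms]
      by (intro eq_if_agree_from_min_lead[OF I x right_ideal_jmult[OF I g v(1)] _ _ _ v(2)])
        (auto simp: b_adic_0)
    with v(1) show ?thesis by blast
  qed
  then have "I = {jmult g v | v. v \<in> Aconv}" using right_ideal_jmult[OF I g] by auto
  then show ?thesis
    unfolding principal_right_ideal_def using right_ideal_Aconv[OF I g] by blast
qed

subsection \<open>Left ideals\<close>

lemma mem_image_jrev_iff: "x \<in> jrev ` I \<longleftrightarrow> jrev x \<in> I"
  by (metis image_iff jrev_jrev)

lemma jrev_image_jrev_image: "jrev ` jrev ` I = I"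
  by (simp add: image_image jrev_jrev)

lemma add_subgroup_jrev_image:
  assumes "add_subgroup I"
  shows "add_subgroup (jrev ` I)"
  using assms Aconv_jrev
  by (fastforce simp: add_subgroup_iff mem_image_jrev_iff jrev_0 jrev_add jrev_diff)

lemma right_ideal_jrev_image:
  assumes "left_ideal I"
  shows "right_ideal (jrev ` I)"
  using assms
  by (simp add: left_ideal_def right_ideal_def add_subgroup_jrev_image mem_image_jrev_iff
      jrev_jmult Aconv_jrev)

lemma normal_right_ideal_jrev_image:
  assumes "normal_left_ideal I"
  shows "normal_right_ideal (jrev ` I)"
  unfolding normal_right_ideal_def
proof (intro conjI ballI impI)
  have I: "left_ideal I" using assms by (simp add: normal_left_ideal_def)
  then show "right_ideal (jrev ` I)" by (rule right_ideal_jrev_image)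
  fix x assume x: "x \<in> Aconv" "jmult x jb \<in> jrev ` I"
  then have "- jmult jb (jrev x) \<in> I" by (simp add: mem_image_jrev_iff jrev_jmult_jb)
  then have "0 - - jmult jb (jrev x) \<in> I"
    using I unfolding left_ideal_def add_subgroup_iff by blast
  then have "jrev x \<in> I" using assms Aconv_jrev[OF x(1)] by (simp add: normal_left_ideal_def)
  then show "x \<in> jrev ` I" by (simp add: mem_image_jrev_iff)
qed

theorem left_noetherian_Aconv: left_noetherian
  unfolding left_noetherian_def
proof (intro allI impI)
  fix I :: "nat \<Rightarrow> jseries set"
  assume "(\<forall>n. left_ideal (I n)) \<and> (\<forall>n. I n \<subseteq> I (Suc n))"
  then have "(\<forall>n. right_ideal (jrev ` I n)) \<and> (\<forall>n. jrev ` I n \<subseteq> jrev ` I (Suc n))"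
    by (auto intro: right_ideal_jrev_image)
  then obtain N where "\<forall>n\<ge>N. jrev ` I n = jrev ` I N"
    using right_noetherian_Aconv[unfolded right_noetherian_def, rule_format, of "\<lambda>n. jrev ` I n"]
    by blast
  then show "\<exists>N. \<forall>n\<ge>N. I n = I N" by (metis jrev_image_jrev_image)
qed

theorem normal_left_ideal_principal:
  assumes "normal_left_ideal I"
  shows "principal_left_ideal I"
proof -
  obtain g where g: "g \<in> Aconv" "jrev ` I = {jmult g x | x. x \<in> Aconv}"
    using normal_right_ideal_principal[OF normal_right_ideal_jrev_image[OF assms]]
    by (auto simp: principal_right_ideal_def)
  have "y \<in> I \<longleftrightarrow> (\<exists>x\<in>Aconv. y = jmult x (jrev g))" for y
  proof -
    have "y \<in> I \<longleftrightarrow> (\<exists>x\<in>Aconv. jrev y = jmult g x)"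
      using g(2) mem_image_jrev_iff[of "jrev y" I] by (auto simp: jrev_jrev)
    also have "\<dots> \<longleftrightarrow> (\<exists>x\<in>Aconv. y = jmult x (jrev g))"
      by (metis Aconv_jrev jrev_jmult jrev_jrev)
    finally show ?thesis .
  qed
  then have "I = {jmult x (jrev g) | x. x \<in> Aconv}" by auto
  then show ?thesis unfolding principal_left_ideal_def using Aconv_jrev[OF g(1)] by blast
qed

theorem theorem1p4p1:
  shows "left_noetherian \<and> right_noetherian
    \<and> (\<forall>I. normal_left_ideal I \<longrightarrow> principal_left_ideal I)
    \<and> (\<forall>I. normal_right_ideal I \<longrightarrow> principal_right_ideal I)"
  using left_noetherian_Aconv right_noetherian_Aconv normal_left_ideal_principal
    normal_right_ideal_principal by blast

end
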